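(* Let $\mathbb{M}$ be a Banach homogeneous group (Banach graded nilpotent Lie group) with gradation $\mathbb{M}=H_1\oplus\cdots\oplus H_\iota$, equipped with its Banach homogeneous distance $\rho$, and assume that $H_1$ (with the restriction of the Banach norm of $\mathbb{M}$) has the Radon-Nikodym property. Let $A\subset\mathbb{R}$ be any subset and let $\gamma\colon A\to(\mathbb{M},\rho)$ be a Lipschitz mapping. Then $\gamma$ is almost everywhere differentiable, that is, for almost every $t\in A$ (with respect to Lebesgue measure) $t$ is a density point of $A$ and $\gamma$ is differentiable at $t$.
   Context: Radon-Nikodym property (RNP): a Banach space $X$ has the RNP if every Lipschitz curve defined on an interval of $\mathbb{R}$ with values in $X$ is almost everywhere (Fréchet) differentiable. Banach homogeneous group: a real Banach space $\mathbb{M}$ with norm $|\cdot|$, equipped with a continuous bilinear skew-symmetric product $[\cdot,\cdot]:\mathbb{M}\times\mathbb{M}\to\mathbb{M}$ satisfying the Jacobi identity, and with closed subspaces $H_1,\dots,H_\iota$ such that $\mathbb{M}=H_1\oplus\cdots\oplus H_\iota$ (meaning that $(s_1,\dots,s_\iota)\mapsto\sum_l s_l$ is an isomorphism of Banach spaces from $H_1\times\cdots\times H_\iota$ onto $\mathbb{M}$) and, whenever $x\in H_i$, $y\in H_j$, one has $[x,y]\in H_{i+j}$ if $i+j\le\iota$ and $[x,y]=0$ otherwise. The Lie algebra is therefore nilpotent, and $\mathbb{M}$ is a group with the operation given by the (finite) Baker-Campbell-Hausdorff sum $xy=x+y+\sum_{m=2}^{\nu}P_m(x,y)$, where $\nu$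 is the step of nilpotence and $P_m(x,y)$ is the homogeneous part of degree $m$ of the Baker-Campbell-Hausdorff series ($P_2(x,y)=\tfrac12[x,y]$); the unit is $0$ and $x^{-1}=-x$. Dilations: for $r>0$, $\delta_r:\mathbb{M}\to\mathbb{M}$ is the linear map with $\delta_r x=r^i x$ for $x\in H_i$. Write $x=\sum_i x_i$ with $x_i\in H_i$. There are constants $\sigma_1=1,\sigma_2,\dots,\sigma_\iota>0$, fixed once and for all, such that $\|x\|=\max\{\sigma_i|x_i|^{1/i}:1\le i\le\iota\}$ satisfies $\|xy\|\le\|x\|+\|y\|$ (and $\|\delta_r x\|=r\|x\|$) for all $x,y\in\mathbb{M}$, $r>0$. The Banach homogeneous distance is $\rho(x,y)=\|x^{-1}y\|$; it is left invariant and satisfies $\rho(\delta_rx,\delta_ry)=r\rho(x,y)$. A point $t$ is a density point of $A\subset\mathbb{R}$ if $\lim_{r\to0^+}\mathcal{L}^1(A\cap(t-r,t+r))/(2r)=1$, with $\mathcal{L}^1$ the Lebesgue (outer) measure. A map $\gamma:A\to\mathbb{M}$ is differentiable at a density point $t\in A$ of $A$ if there is an h-homomorphism $L:\mathbb{R}\to\mathbb{M}$, i.e. a continuous group homomorphism from $(\mathbb{R},+)$ to $\mathbb{M}$ with $L(rh)=\delta_rL(h)$ for all $h\in\mathbb{R}$ and $r>0$, such that $\rho(\gamma(t)^{-1}\gamma(t+h),L(h))=o(|h|)$ as $h\to0$ with $t+h\in A$. *)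

theory Defs
  imports "HOL-Analysis.Analysis"
begin

section \<open>Graded Banach Lie algebras\<close>

text \<open>
  The ambient Banach space is the type \<open>'m\<close>; only the layers with index in
  \<open>{1..depth}\<close> and the constants \<open>scale i\<close> with \<open>i\<close> in the same range are meaningful.
\<close>

record 'm graded_structure =
  bracket :: "'m \<Rightarrow> 'm \<Rightarrow> 'm"
  layer :: "nat \<Rightarrow> 'm set"
  depth :: nat
  scale :: "nat \<Rightarrow> real"

definition layer_prod :: "'m::banach graded_structure \<Rightarrow> (nat \<Rightarrow> 'm) set" where
  "layer_prod G = (\<Pi>\<^sub>E i\<in>{1..depth G}. layer G i)"

definition layer_sum :: "'m::banach graded_structure \<Rightarrow> (nat \<Rightarrow> 'm) \<Rightarrow> 'm" where
  "layer_sum G s = (\<Sum>i\<in>{1..depth G}. s i)"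

definition component :: "'m::banach graded_structure \<Rightarrow> nat \<Rightarrow> 'm \<Rightarrow> 'm" where
  "component G i x = the_inv_into (layer_prod G) (layer_sum G) x i"

text \<open>
  \<open>layer_sum\<close> is additive and homogeneous by construction; being an isomorphism of Banach
  spaces therefore means bijectivity together with a two-sided bound with respect to the
  maximum norm of the product.
\<close>

definition direct_sum_decomposition :: "'m::banach graded_structure \<Rightarrow> bool" where
  "direct_sum_decomposition G \<longleftrightarrow>
     depth G \<ge> 1 \<and>
     (\<forall>i\<in>{1..depth G}. subspace (layer G i) \<and> closed (layer G i)) \<and>
     bij_betw (layer_sum G) (layer_prod G) UNIV \<and>
     (\<exists>c>0. \<exists>C. \<forall>s\<in>layer_prod G.
        c * Max ((\<lambda>i. norm (s i)) ` {1..depth G}) \<le> norm (layer_sum G s) \<and>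
        norm (layer_sum G s) \<le> C * Max ((\<lambda>i. norm (s i)) ` {1..depth G}))"

definition graded_banach_lie_algebra :: "'m::banach graded_structure \<Rightarrow> bool" where
  "graded_banach_lie_algebra G \<longleftrightarrow>
     bounded_bilinear (bracket G) \<and>
     (\<forall>x y. bracket G x y = - bracket G y x) \<and>
     (\<forall>x y z. bracket G x (bracket G y z) + bracket G y (bracket G z x)
              + bracket G z (bracket G x y) = 0) \<and>
     direct_sum_decomposition G \<and>
     (\<forall>i\<in>{1..depth G}. \<forall>j\<in>{1..depth G}. \<forall>x\<in>layer G i. \<forall>y\<in>layer G j.
        (if i + j \<le> depth G then bracket G x y \<in> layer G (i + j) else bracket G x y = 0))"


section \<open>The Baker-Campbell-Hausdorff product\<close>

text \<open>Right-nested brackets: \<open>lie_word G [x1, \<dots>, xn] = [x1, [x2, \<dots> [x(n-1), xn]\<dots>]]\<close>.\<close>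

fun lie_word :: "'m::banach graded_structure \<Rightarrow> 'm list \<Rightarrow> 'm" where
  "lie_word G [] = 0"
| "lie_word G [x] = x"
| "lie_word G (x # y # zs) = bracket G x (lie_word G (y # zs))"

definition nilpotency_step :: "'m::banach graded_structure \<Rightarrow> nat" where
  "nilpotency_step G = (LEAST n. \<forall>xs. length xs = Suc n \<longrightarrow> lie_word G xs = 0)"

definition dynkin_indices :: "nat \<Rightarrow> nat \<Rightarrow> (nat \<times> nat) list set" where
  "dynkin_indices k m =
     {ps. length ps = k \<and> (\<forall>(r, s)\<in>set ps. r + s > 0) \<and> (\<Sum>(r, s)\<leftarrow>ps. r + s) = m}"

lemma finite_dynkin_indices: "finite (dynkin_indices k m)"
proof (rule finite_subset)
  have "r \<le> m \<and> s \<le> m" if "ps \<in> dynkin_indices k m" "(r, s) \<in> set ps" for ps r s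
  proof -
    have "r + s \<in> set (map (\<lambda>(r, s). r + s) ps)"
      unfolding set_map by (rule image_eqI[OF _ that(2)]) simp
    then have "r + s \<le> (\<Sum>(r, s)\<leftarrow>ps. r + s)"
      by (rule member_le_sum_list) simp
    then show ?thesis
      using that(1) by (simp add: dynkin_indices_def)
  qed
  moreover have "length ps = k" if "ps \<in> dynkin_indices k m" for ps
    using that by (simp add: dynkin_indices_def)
  ultimately show "dynkin_indices k m \<subseteq> {ps. set ps \<subseteq> {..m} \<times> {..m} \<and> length ps = k}"
    by fast
  show "finite {ps. set ps \<subseteq> {..m} \<times> {..m} \<and> length ps = k}"
    by (rule finite_lists_length_eq) simp
qed

text \<open>
  The degree-\<open>m\<close> part of the Baker-Campbell-Hausdorff series \<open>log (exp x exp y)\<close> by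
  Dynkin's formula:
  the sum over \<open>k\<close> and over \<open>(r1, s1), \<dots>, (rk, sk)\<close> with \<open>ri + si > 0\<close> and total degree \<open>m\<close> of
  \<open>(-1)^(k-1) / (k m \<Prod>i ri! si!) [x^r1 y^s1 \<dots> x^rk y^sk]\<close>.
\<close>

definition bch_part :: "'m::banach graded_structure \<Rightarrow> nat \<Rightarrow> 'm \<Rightarrow> 'm \<Rightarrow> 'm" where
  "bch_part G m x y =
     (\<Sum>k = 1..m. \<Sum>ps\<in>dynkin_indices k m.
        ((-1) ^ (k - 1) / (real k * real m * (\<Prod>(r, s)\<leftarrow>ps. fact r * fact s)))
        *\<^sub>R lie_word G (concat (map (\<lambda>(r, s). replicate r x @ replicate s y) ps)))"

definition gmult :: "'m::banach graded_structure \<Rightarrow> 'm \<Rightarrow> 'm \<Rightarrow> 'm" where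
  "gmult G x y = x + y + (\<Sum>m = 2..nilpotency_step G. bch_part G m x y)"

text \<open>The unit of this product is \<open>0\<close> and the inverse of \<open>x\<close> is \<open>- x\<close>.\<close>


section \<open>Homogeneous norm and distance\<close>

definition dilation :: "'m::banach graded_structure \<Rightarrow> real \<Rightarrow> 'm \<Rightarrow> 'm" where
  "dilation G r x = (\<Sum>i\<in>{1..depth G}. r ^ i *\<^sub>R component G i x)"

definition hnorm :: "'m::banach graded_structure \<Rightarrow> 'm \<Rightarrow> real" where
  "hnorm G x = Max ((\<lambda>i. scale G i * root i (norm (component G i x))) ` {1..depth G})"

definition hdist :: "'m::banach graded_structure \<Rightarrow> 'm \<Rightarrow> 'm \<Rightarrow> real" where
  "hdist G x y = hnorm G (gmult G (- x) y)"

definition banach_homogeneous_group :: "'m::banach graded_structure \<Rightarrow> bool" where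
  "banach_homogeneous_group G \<longleftrightarrow>
     graded_banach_lie_algebra G \<and>
     scale G 1 = 1 \<and>
     (\<forall>i\<in>{1..depth G}. scale G i > 0) \<and>
     (\<forall>x y. hnorm G (gmult G x y) \<le> hnorm G x + hnorm G y)"


section \<open>Differentiability\<close>

text \<open>The Radon-Nikodym property of a closed subspace \<open>X\<close>, with the restricted norm.\<close>

definition radon_nikodym_property :: "'m::banach set \<Rightarrow> bool" where
  "radon_nikodym_property X \<longleftrightarrow>
     (\<forall>I (f :: real \<Rightarrow> 'm) C. is_interval I \<and> f ` I \<subseteq> X \<and> C-lipschitz_on I f \<longrightarrow>
        (AE t in lebesgue. t \<in> I \<longrightarrow> (\<exists>v\<in>X. (f has_vector_derivative v) (at t within I))))"

text \<open>The set \<open>A\<close> need not be measurable, hence the outer measure.\<close>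

definition density_point :: "real set \<Rightarrow> real \<Rightarrow> bool" where
  "density_point A t \<longleftrightarrow>
     ((\<lambda>r. enn2real (outer_measure_of lebesgue (A \<inter> {t - r<..<t + r})) / (2 * r))
        \<longlongrightarrow> 1) (at_right 0)"

definition h_homomorphism :: "'m::banach graded_structure \<Rightarrow> (real \<Rightarrow> 'm) \<Rightarrow> bool" where
  "h_homomorphism G L \<longleftrightarrow>
     continuous_on UNIV L \<and>
     (\<forall>s t. L (s + t) = gmult G (L s) (L t)) \<and>
     (\<forall>h. \<forall>r>0. L (r * h) = dilation G r (L h))"

definition h_lipschitz_on :: "'m::banach graded_structure \<Rightarrow> real set \<Rightarrow> (real \<Rightarrow> 'm) \<Rightarrow> bool" where
  "h_lipschitz_on G A \<gamma> \<longleftrightarrow>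
     (\<exists>C. \<forall>s\<in>A. \<forall>t\<in>A. hdist G (\<gamma> s) (\<gamma> t) \<le> C * \<bar>s - t\<bar>)"

definition h_differentiable_at ::
    "'m::banach graded_structure \<Rightarrow> real set \<Rightarrow> (real \<Rightarrow> 'm) \<Rightarrow> real \<Rightarrow> bool" where
  "h_differentiable_at G A \<gamma> t \<longleftrightarrow>
     (\<exists>L. h_homomorphism G L \<and>
        ((\<lambda>h. hdist G (gmult G (- \<gamma> t) (\<gamma> (t + h))) (L h) / \<bar>h\<bar>) \<longlongrightarrow> 0)
          (at 0 within {h. t + h \<in> A}))"

end

theory Submission
  imports Defs
begin

text \<open>
  The horizontal part of \<open>\<gamma>\<close>, its component in the first layer, is Lipschitz for the Banach norm.
  It extends to a Lipschitz curve on the whole line with values in that layer (interpolate linearly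
  in the gaps of the closure of \<open>A\<close>), so the Radon-Nikodym property gives it a derivative \<open>v\<close> at
  almost every \<open>t\<close>; and almost every \<open>t\<in>A\<close> is a density point of \<open>A\<close>, by Vitali's covering theorem.
  At a \<open>t\<in>A\<close> with both properties the differential of \<open>\<gamma>\<close> is \<open>h \<mapsto> h v\<close>, for the following reason.

  Fix a large \<open>N\<close>. For small \<open>h\<close> with \<open>t+h\<in>A\<close>, density provides points \<open>t = t\<^sub>0, \<dots>, t\<^sub>N = t+h\<close> of \<open>A\<close>
  that are nearly equally spaced, and \<open>\<gamma>(t)\<^sup>-\<^sup>1\<gamma>(t+h)\<close> is the product of the increments
  \<open>\<gamma>(t\<^sub>k)\<^sup>-\<^sup>1\<gamma>(t\<^sub>k\<^sub>+\<^sub>1)\<close>. After the dilation by \<open>1/|h|\<close> every increment has homogeneous norm \<open>O(1/N)\<close>, so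
  its components in the layers \<open>i \<ge> 2\<close> are \<open>O(N\<^sup>-\<^sup>i)\<close>, hence \<open>O(1/N\<^sup>2)\<close>; and since \<open>v\<close> is the derivative of
  the horizontal part at \<open>t\<close> and \<open>h\<close> may be chosen after \<open>N\<close>, its horizontal component differs from the
  corresponding multiple of \<open>v\<close> by \<open>O(1/N\<^sup>2)\<close> as well. Thus each increment is a multiple of \<open>v\<close> times an
  error of Banach norm \<open>O(1/N\<^sup>2)\<close>. Collecting the multiples of \<open>v\<close> on the left conjugates the errors
  by bounded elements only, so the product of the \<open>N\<close> errors is \<open>O(1/N)\<close>: this is
  \<open>product_of_nearly_horizontal_increments\<close>, and \<open>h_differentiable_at_if_horizontal_derivative\<close> draws
  the conclusion.

  This argument uses that the Baker-Campbell-Hausdorff product, which is defined by Dynkin's formula, is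
  a group law. The gradation makes a direct proof possible. Let \<open>D\<close> be the derivation that multiplies
  the layer \<open>i\<close> by \<open>i\<close>. Then \<open>x \<mapsto> ((u, a) \<mapsto> ([x, u] - a D x, 0))\<close> represents the Lie algebra by nilpotent
  operators on \<open>'m \<times> \<real>\<close>, and it is faithful because \<open>D\<close> is injective. In the Banach algebra of bounded
  operators \<open>exp (rep (x y)) = exp (rep x) exp (rep y)\<close> (\<open>exp_rep_gmult\<close>), from which the group
  laws are immediate; the same exponentials serve for the norm estimates. To prove the identity, put
  \<open>t\<close> in front of \<open>x\<close> and \<open>y\<close>. Dynkin's formula says that \<open>Z t = (t x)(t y)\<close> satisfies
  \<open>Z' = q(E) (x + E y)\<close>, where \<open>E = exp (t ad x) exp (t ad y)\<close> and \<open>q(e\<^sup>z) = z/(e\<^sup>z - 1)\<close>. On the other hand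
  the formula for the derivative of the exponential shows that \<open>W = exp (rep (Z t))\<close> would satisfy
  \<open>W' = rep x W + W rep y\<close>, the equation of \<open>exp (t rep x) exp (t rep y)\<close>, if \<open>Z'\<close> were \<open>q(W) (x + W y)\<close>. So
  the difference of the two curves has a derivative bounded by a multiple of that difference, and
  vanishes.
\<close>

section \<open>Exponentials in a Banach algebra\<close>

definition commutator :: "'b::ring \<Rightarrow> 'b \<Rightarrow> 'b" where
  "commutator a b = a * b - b * a"

lemma power_times_eq_sum_commutators:
  fixes a b :: "'b::real_algebra_1"
  shows "a ^ n * b = (\<Sum>k\<le>n. real (n choose k) *\<^sub>R ((commutator a ^^ k) b * a ^ (n - k)))"
proof (induction n)
  case 0
  then show ?case by simp
next
  case (Suc n)
  let ?c = "\<lambda>k. (commutator a ^^ k) b"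
  have step: "a * ?c k = ?c (Suc k) + ?c k * a" for k
    by (simp add: commutator_def)
  have "a ^ Suc n * b = a * (a ^ n * b)"
    by (simp add: mult.assoc)
  also have "\<dots> = (\<Sum>k\<le>n. real (n choose k) *\<^sub>R (a * ?c k * a ^ (n - k)))"
    by (simp add: Suc.IH sum_distrib_left mult.assoc)
  also have "\<dots> = (\<Sum>k\<le>n. real (n choose k) *\<^sub>R (?c (Suc k) * a ^ (n - k)))
      + (\<Sum>k\<le>n. real (n choose k) *\<^sub>R (?c k * a ^ (Suc n - k)))"
    unfolding step sum.distrib[symmetric]
    by (intro sum.cong refl)
      (simp add: distrib_right scaleR_right_distrib mult.assoc Suc_diff_le)
  also have "(\<Sum>k\<le>n. real (n choose k) *\<^sub>R (?c k * a ^ (Suc n - k)))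
      = (\<Sum>k\<le>Suc n. real (n choose k) *\<^sub>R (?c k * a ^ (Suc n - k)))"
    by simp
  also have "\<dots> = ?c 0 * a ^ Suc n
      + (\<Sum>k\<le>n. real (n choose Suc k) *\<^sub>R (?c (Suc k) * a ^ (n - k)))"
    by (subst sum.atMost_Suc_shift) simp
  finally have "a ^ Suc n * b = ?c 0 * a ^ Suc n +
      (\<Sum>k\<le>n. real (Suc n choose Suc k) *\<^sub>R (?c (Suc k) * a ^ (n - k)))"
    by (simp add: sum.distrib scaleR_left_distrib algebra_simps)
  then show ?case
    by (subst sum.atMost_Suc_shift) simp
qed

text \<open>
  The left side is the derivative of \<open>a\<^sup>n\<close> in the direction \<open>b\<close>. Moving each \<open>b\<close> to the left by the
  previous lemma leaves the hockey-stick sums \<open>\<Sum>i<n. i choose k\<close>.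
\<close>

lemma sum_power_times_power_eq_sum_commutators:
  fixes a b :: "'b::real_algebra_1"
  shows "(\<Sum>i<n. a ^ i * b * a ^ (n - Suc i))
    = (\<Sum>k<n. real (n choose Suc k) *\<^sub>R ((commutator a ^^ k) b * a ^ (n - Suc k)))"
proof -
  let ?c = "\<lambda>k. (commutator a ^^ k) b"
  have choose: "(\<Sum>i<n. i choose k) = n choose Suc k" for k
    by (cases n) (simp_all add: lessThan_Suc_atMost sum_choose_upper)
  have "(\<Sum>i<n. a ^ i * b * a ^ (n - Suc i))
      = (\<Sum>i<n. \<Sum>k<n. real (i choose k) *\<^sub>R (?c k * a ^ (n - Suc k)))"
  proof (rule sum.cong[OF refl])
    fix i assume "i \<in> {..<n}"
    have "a ^ i * b * a ^ (n - Suc i)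
        = (\<Sum>k\<le>i. real (i choose k) *\<^sub>R (?c k * a ^ (i - k) * a ^ (n - Suc i)))"
      by (simp add: power_times_eq_sum_commutators sum_distrib_right)
    also have "\<dots> = (\<Sum>k\<le>i. real (i choose k) *\<^sub>R (?c k * a ^ (n - Suc k)))"
    proof (rule sum.cong[OF refl])
      fix k assume "k \<in> {..i}"
      then have "i - k + (n - Suc i) = n - Suc k"
        using \<open>i \<in> {..<n}\<close> by auto
      then show "real (i choose k) *\<^sub>R (?c k * a ^ (i - k) * a ^ (n - Suc i))
          = real (i choose k) *\<^sub>R (?c k * a ^ (n - Suc k))"
        by (simp add: mult.assoc power_add[symmetric])
    qed
    also have "\<dots> = (\<Sum>k<n. real (i choose k) *\<^sub>R (?c k * a ^ (n - Suc k)))"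
      using \<open>i \<in> {..<n}\<close> by (intro sum.mono_neutral_left) (auto simp: not_le binomial_eq_0)
    finally show "a ^ i * b * a ^ (n - Suc i)
        = (\<Sum>k<n. real (i choose k) *\<^sub>R (?c k * a ^ (n - Suc k)))" .
  qed
  also have "\<dots> = (\<Sum>k<n. real (\<Sum>i<n. i choose k) *\<^sub>R (?c k * a ^ (n - Suc k)))"
    by (subst sum.swap) (simp add: scaleR_left.sum)
  finally show ?thesis
    unfolding choose .
qed

lemma nilpotent_power_zero:
  fixes a :: "'b::semiring_1"
  assumes "a ^ N = 0" "N \<le> n"
  shows "a ^ n = 0"
  using assms by (metis le_add_diff_inverse mult_zero_left power_add)

lemma exp_nilpotent:
  fixes a :: "'b::{real_normed_algebra_1, banach}"
  assumes "a ^ N = 0" "N \<le> M"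
  shows "exp a = (\<Sum>n<M. (1 / fact n) *\<^sub>R a ^ n)"
  unfolding exp_def
  by (subst suminf_finite[of "{..<M}"])
    (auto simp: nilpotent_power_zero[OF assms(1)] assms(2) not_less divide_inverse
      intro!: nilpotent_power_zero[OF assms(1)] order_trans[OF assms(2)])

text \<open>
  This is \<open>e\<^sup>a b e\<^sup>-\<^sup>a = e\<^bsup>ad a\<^esup> b\<close>: dividing \<open>power_times_eq_sum_commutators\<close> by \<open>n!\<close> turns the binomial sum
  into a Cauchy product.
\<close>

lemma exp_times_eq_sum_commutators:
  fixes a b :: "'b::{real_normed_algebra_1, banach}"
  assumes c0: "\<And>k. N \<le> k \<Longrightarrow> (commutator a ^^ k) b = 0"
  shows "exp a * b = (\<Sum>k<N. (1 / fact k) *\<^sub>R (commutator a ^^ k) b) * exp a"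
proof -
  let ?c = "\<lambda>k. (1 / fact k) *\<^sub>R (commutator a ^^ k) b"
  let ?e = "\<lambda>n. (1 / fact n) *\<^sub>R a ^ n"
  have se: "summable (\<lambda>n. norm (?e n))" and e: "?e sums exp a"
    using summable_norm_exp[of a] exp_converges[of a] by (simp_all add: divide_inverse)
  have sc: "summable (\<lambda>k. norm (?c k))"
    by (rule summable_finite[of "{..<N}"]) (simp_all add: c0)
  have c: "(\<Sum>k. ?c k) = (\<Sum>k<N. ?c k)"
    by (rule suminf_finite) (simp_all add: c0)
  have "(\<lambda>n. \<Sum>k\<le>n. ?c k * ?e (n - k)) sums ((\<Sum>k. ?c k) * (\<Sum>n. ?e n))"
    using Cauchy_product_sums[OF sc se] .
  moreover have "(\<Sum>k\<le>n. ?c k * ?e (n - k)) = ?e n * b" for n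
  proof -
    have "?e n * b = (1 / fact n) *\<^sub>R
        (\<Sum>k\<le>n. real (n choose k) *\<^sub>R ((commutator a ^^ k) b * a ^ (n - k)))"
      by (simp add: power_times_eq_sum_commutators)
    also have "\<dots> = (\<Sum>k\<le>n. ?c k * ?e (n - k))"
      unfolding scaleR_sum_right
      by (intro sum.cong refl) (simp add: binomial_fact)
    finally show ?thesis by simp
  qed
  moreover have "(\<lambda>n. ?e n * b) sums (exp a * b)"
    by (rule sums_mult2[OF e])
  ultimately show ?thesis
    using e c by (simp add: sums_iff)
qed

lemma has_vector_derivative_power_noncommutative:
  fixes A :: "real \<Rightarrow> 'b::real_normed_algebra_1"
  assumes "(A has_vector_derivative A') (at t within S)"
  shows "((\<lambda>s. A s ^ n) has_vector_derivative (\<Sum>i<n. A t ^ i * A' * A t ^ (n - Suc i)))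
    (at t within S)"
proof (induction n)
  case 0
  then show ?case by simp
next
  case (Suc n)
  have "(\<Sum>i<Suc n. A t ^ i * A' * A t ^ (Suc n - Suc i))
      = A t * (\<Sum>i<n. A t ^ i * A' * A t ^ (n - Suc i)) + A' * A t ^ n"
    by (subst sum.lessThan_Suc_shift) (simp add: sum_distrib_left mult.assoc)
  then show ?case
    using has_vector_derivative_mult[OF assms Suc.IH] by simp
qed

text \<open>
  The classical formula \<open>(e\<^sup>A)' = \<phi>(ad A)(A') e\<^sup>A\<close> with \<open>\<phi>(z) = (e\<^sup>z - 1)/z\<close>. Nilpotency makes the exponential
  a finite sum, which can be differentiated term by term, and again a Cauchy product appears.
\<close>

lemma has_vector_derivative_exp_nilpotent:
  fixes A :: "real \<Rightarrow> 'b::{real_normed_algebra_1, banach}"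
  assumes A: "(A has_vector_derivative A') (at t within S)"
    and nil: "\<And>s. A s ^ N = 0"
    and c0: "\<And>k. N \<le> k \<Longrightarrow> (commutator (A t) ^^ k) A' = 0"
  shows "((\<lambda>s. exp (A s)) has_vector_derivative
    (\<Sum>k<N. (1 / fact (Suc k)) *\<^sub>R (commutator (A t) ^^ k) A') * exp (A t)) (at t within S)"
proof -
  let ?c = "\<lambda>k. (1 / fact (Suc k)) *\<^sub>R (commutator (A t) ^^ k) A'"
  let ?e = "\<lambda>n. (1 / fact n) *\<^sub>R A t ^ n"
  let ?D = "\<lambda>n. \<Sum>i<n. A t ^ i * A' * A t ^ (n - Suc i)"
  have D: "(1 / fact (Suc m)) *\<^sub>R ?D (Suc m) = (\<Sum>k\<le>m. ?c k * ?e (m - k))" for m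
  proof -
    have *: "real (Suc m choose Suc k) / fact (Suc m) = 1 / fact (Suc k) * (1 / fact (m - k))"
      if "k \<le> m" for k
      using that by (subst binomial_fact) (auto simp: field_simps simp del: fact_Suc binomial_Suc_Suc)
    have "?D (Suc m) = (\<Sum>k\<le>m. real (Suc m choose Suc k) *\<^sub>R ((commutator (A t) ^^ k) A' * A t ^ (m - k)))"
      using sum_power_times_power_eq_sum_commutators[of "A t" A' "Suc m"]
      by (simp only: lessThan_Suc_atMost diff_Suc_Suc)
    then have "(1 / fact (Suc m)) *\<^sub>R ?D (Suc m) = (\<Sum>k\<le>m.
        (real (Suc m choose Suc k) / fact (Suc m)) *\<^sub>R ((commutator (A t) ^^ k) A' * A t ^ (m - k)))"
      by (simp only: scaleR_sum_right scaleR_scaleR) simp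
    also have "\<dots> = (\<Sum>k\<le>m. ?c k * ?e (m - k))"
      using * by (intro sum.cong refl) (simp del: fact_Suc binomial_Suc_Suc)
    finally show ?thesis .
  qed
  have se: "summable (\<lambda>n. norm (?e n))" and e: "?e sums exp (A t)"
    using summable_norm_exp[of "A t"] exp_converges[of "A t"] by (simp_all add: divide_inverse)
  have sc: "summable (\<lambda>k. norm (?c k))"
    by (rule summable_finite[of "{..<N}"]) (simp_all add: c0)
  have c: "(\<Sum>k. ?c k) = (\<Sum>k<N. ?c k)"
    by (rule suminf_finite) (simp_all add: c0)
  have "(\<lambda>n. \<Sum>k\<le>n. ?c k * ?e (n - k)) sums ((\<Sum>k. ?c k) * (\<Sum>n. ?e n))"
    using Cauchy_product_sums[OF sc se] .
  moreover have "(\<lambda>n. \<Sum>k\<le>n. ?c k * ?e (n - k)) sums (\<Sum>n<2 * N. \<Sum>k\<le>n. ?c k * ?e (n - k))"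
  proof (rule sums_finite)
    fix n assume "n \<notin> {..<2 * N}"
    have "?c k * ?e (n - k) = 0" for k
    proof (cases "N \<le> k")
      case False
      then have "A t ^ (n - k) = 0"
        using \<open>n \<notin> {..<2 * N}\<close> by (intro nilpotent_power_zero[OF nil]) auto
      then show ?thesis by simp
    qed (use c0 in simp)
    then show "(\<Sum>k\<le>n. ?c k * ?e (n - k)) = 0" by simp
  qed simp
  \<comment> \<open>the terms with \<open>m \<ge> 2 N\<close> vanish: one of the two factors has an exponent at least \<open>N\<close>\<close>
  ultimately have total: "(\<Sum>m<2 * N. (1 / fact (Suc m)) *\<^sub>R ?D (Suc m)) = (\<Sum>k<N. ?c k) * exp (A t)"
    using c e unfolding D by (simp add: sums_iff)
  have "((\<lambda>s. \<Sum>n<Suc (2 * N). (1 / fact n) *\<^sub>R A s ^ n) has_vector_derivative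
      (\<Sum>n<Suc (2 * N). (1 / fact n) *\<^sub>R ?D n)) (at t within S)"
    by (intro has_vector_derivative_sum has_vector_derivative_power_noncommutative[OF A]
      bounded_linear.has_vector_derivative[OF bounded_linear_scaleR_right])
  moreover have "(\<Sum>n<Suc (2 * N). (1 / fact n) *\<^sub>R A s ^ n) = exp (A s)" for s
    by (rule exp_nilpotent[OF nil, symmetric]) simp
  moreover have "(\<Sum>n<Suc (2 * N). (1 / fact n) *\<^sub>R ?D n) = (\<Sum>k<N. ?c k) * exp (A t)"
    using total by (subst sum.lessThan_Suc_shift) (simp del: fact_Suc sum.lessThan_Suc)
  ultimately show ?thesis by simp
qed

text \<open>
  Identities between formal power series, including those for compositions, carry over to a nilpotent
  element of any real algebra, since truncation at its order of nilpotency loses nothing.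
\<close>

definition fps_eval_nilpotent :: "nat \<Rightarrow> 'b::real_algebra_1 \<Rightarrow> real fps \<Rightarrow> 'b" where
  "fps_eval_nilpotent N a f = (\<Sum>n<N. fps_nth f n *\<^sub>R a ^ n)"

lemma fps_eval_nilpotent_mult:
  fixes a :: "'b::real_algebra_1"
  assumes nil: "a ^ N = 0"
  shows "fps_eval_nilpotent N a (f * g) = fps_eval_nilpotent N a f * fps_eval_nilpotent N a g"
proof -
  let ?S = "{(i, j). i < N \<and> j < N}"
  let ?h = "\<lambda>(i, j). (fps_nth f i * fps_nth g j) *\<^sub>R a ^ (i + j)"
  have "fps_eval_nilpotent N a f * fps_eval_nilpotent N a g = (\<Sum>i<N. \<Sum>j<N. ?h (i, j))"
    unfolding fps_eval_nilpotent_def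
    by (simp add: sum_product power_add mult.commute)
  also have "\<dots> = sum ?h ({..<N} \<times> {..<N})"
    by (simp add: sum.cartesian_product)
  also have "\<dots> = sum ?h {(i, j). i + j < N}"
    by (rule sum.mono_neutral_right) (auto, metis nilpotent_power_zero[OF nil] not_less)
  also have "\<dots> = sum ?h (SIGMA i:{..<N}. {..<N - i})"
    by (rule sum.cong) auto
  also have "\<dots> = (\<Sum>n<N. \<Sum>i\<le>n. ?h (i, n - i))"
  proof -
    have "sum ?h {(i, j). i + j < N} = (\<Sum>n<N. \<Sum>i\<le>n. ?h (i, n - i))"
      using sum.triangle_reindex[of "\<lambda>i j. ?h (i, j)" N] by simp
    moreover have "{(i, j). i + j < N} = (SIGMA i:{..<N}. {..<N - i})"
      by auto
    ultimately show ?thesis by simp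
  qed
  also have "\<dots> = fps_eval_nilpotent N a (f * g)"
    unfolding fps_eval_nilpotent_def fps_mult_nth atLeast0AtMost
    by (simp add: scaleR_sum_left)
  finally show ?thesis by simp
qed

lemma fps_eval_nilpotent_1: "a ^ N = (0::'b::real_algebra_1) \<Longrightarrow> fps_eval_nilpotent N a 1 = 1"
proof -
  assume nil: "a ^ N = 0"
  have "fps_nth 1 n *\<^sub>R a ^ n = (if n = 0 then 1 else 0)" for n
    by simp
  then show ?thesis
    using nil by (cases "N = 0") (auto simp: fps_eval_nilpotent_def simp del: fps_one_nth)
qed

lemma fps_eval_nilpotent_power:
  fixes a :: "'b::real_algebra_1"
  assumes nil: "a ^ N = 0"
  shows "fps_eval_nilpotent N a (f ^ n) = fps_eval_nilpotent N a f ^ n"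
  by (induction n) (simp_all add: fps_eval_nilpotent_1 fps_eval_nilpotent_mult nil)

lemma fps_eval_nilpotent_compose:
  fixes a :: "'b::real_algebra_1"
  assumes nil: "a ^ N = 0" and g0: "fps_nth g 0 = 0"
  shows "fps_eval_nilpotent N a (f oo g) = (\<Sum>n<N. fps_nth f n *\<^sub>R fps_eval_nilpotent N a g ^ n)"
proof -
  have "fps_eval_nilpotent N a (f oo g) = (\<Sum>i<N. \<Sum>n<N. (fps_nth f n * fps_nth (g ^ n) i) *\<^sub>R a ^ i)"
    unfolding fps_eval_nilpotent_def
  proof (rule sum.cong[OF refl])
    fix i assume "i \<in> {..<N}"
    then have "(\<Sum>n=0..i. fps_nth f n * fps_nth (g ^ n) i) = (\<Sum>n<N. fps_nth f n * fps_nth (g ^ n) i)"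
      by (intro sum.mono_neutral_left) (auto simp: startsby_zero_power_prefix[OF g0])
    then show "fps_nth (f oo g) i *\<^sub>R a ^ i = (\<Sum>n<N. (fps_nth f n * fps_nth (g ^ n) i) *\<^sub>R a ^ i)"
      by (simp add: fps_compose_nth scaleR_sum_left)
  qed
  also have "\<dots> = (\<Sum>n<N. fps_nth f n *\<^sub>R fps_eval_nilpotent N a (g ^ n))"
    by (subst sum.swap) (simp add: fps_eval_nilpotent_def scaleR_sum_right)
  finally show ?thesis
    by (simp add: fps_eval_nilpotent_power[OF nil])
qed

text \<open>
  With \<open>\<phi>(z) = (e\<^sup>z - 1)/z\<close> and \<open>q(w) = log w/(w - 1)\<close> this is the identity \<open>\<phi>(z) q(e\<^sup>z) = 1\<close>, which holds for
  formal power series because the logarithm is the compositional inverse of \<open>e\<^sup>z - 1\<close>.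
\<close>

lemma exp_quotient_times_log_quotient:
  fixes a :: "'b::{real_normed_algebra_1, banach}"
  assumes nil: "a ^ N = 0"
  shows "(\<Sum>k<N. (1 / fact (Suc k)) *\<^sub>R a ^ k)
    * (\<Sum>k<N. ((- 1) ^ k / real (Suc k)) *\<^sub>R (exp a - 1) ^ k) = 1" (is "?\<phi> * ?q = 1")
    and "(\<Sum>k<N. ((- 1) ^ k / real (Suc k)) *\<^sub>R (exp a - 1) ^ k)
    * (\<Sum>k<N. (1 / fact (Suc k)) *\<^sub>R a ^ k) = 1"
proof -
  define \<phi> :: "real fps" where "\<phi> = Abs_fps (\<lambda>k. 1 / fact (Suc k))"
  define q :: "real fps" where "q = Abs_fps (\<lambda>k. (- 1) ^ k / real (Suc k))"
  define g :: "real fps" where "g = fps_exp 1 - 1"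
  have g: "g = fps_X * \<phi>"
    by (rule fps_ext) (auto simp: g_def \<phi>_def fps_mult_fps_X_commute[symmetric]
        fps_nth_Abs_fps gr0_conv_Suc split: nat.splits)
  have ln: "fps_ln 1 = fps_X * q"
    by (rule fps_ext) (auto simp: q_def fps_ln_nth gr0_conv_Suc)
  have g0: "fps_nth g 0 = 0" and g1: "fps_nth g 1 \<noteq> 0"
    by (auto simp: g_def)
  have "fps_ln 1 oo g = fps_X"
    using fps_inv[OF g0 g1] fps_ln_fps_exp_inv[of "1::real"] by (simp add: g_def)
  then have "g * (q oo g) = fps_X"
    unfolding ln by (simp add: fps_compose_mult_distrib[OF g0] g0)
  then have "fps_X * (\<phi> * (q oo g)) = fps_X * 1"
    unfolding g by (simp add: mult.assoc)
  then have "\<phi> * (q oo g) = 1"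
    using mult_left_cancel[OF fps_X_neq_zero] by blast
  then have "fps_eval_nilpotent N a \<phi> * fps_eval_nilpotent N a (q oo g) = 1"
    and "fps_eval_nilpotent N a (q oo g) * fps_eval_nilpotent N a \<phi> = 1"
    by (metis fps_eval_nilpotent_1[OF nil] fps_eval_nilpotent_mult[OF nil] mult.commute)+
  moreover have "fps_eval_nilpotent N a g = exp a - 1"
  proof (cases N)
    case 0
    then have "(1::'b) = 0" using nil by simp
    then show ?thesis by simp
  next
    case (Suc M)
    show ?thesis
      unfolding exp_nilpotent[OF nil order_refl] fps_eval_nilpotent_def Suc
      by (simp only: sum.lessThan_Suc_shift) (simp add: g_def algebra_simps)
  qed
  then have "fps_eval_nilpotent N a (q oo g) = ?q"
    by (simp add: fps_eval_nilpotent_compose[OF nil g0] q_def)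
  moreover have "fps_eval_nilpotent N a \<phi> = ?\<phi>"
    by (simp add: fps_eval_nilpotent_def \<phi>_def del: fact_Suc)
  ultimately show "?\<phi> * ?q = 1" "?q * ?\<phi> = 1"
    by simp_all
qed

lemma norm_power_diff_le:
  fixes a b :: "'b::real_normed_algebra_1"
  assumes "norm a \<le> R" "norm b \<le> R"
  shows "norm (a ^ n - b ^ n) \<le> real n * R ^ (n - 1) * norm (a - b)"
proof (induction n)
  case (Suc n)
  have "R \<ge> 0" using assms(1) norm_ge_zero[of a] by linarith
  have "norm (a ^ n) \<le> R ^ n"
    using norm_power_ineq[of a n] power_mono[OF assms(1) norm_ge_zero, of n] by linarith
  have "a ^ Suc n - b ^ Suc n = (a - b) * a ^ n + b * (a ^ n - b ^ n)"
    by (simp add: algebra_simps)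
  then have "norm (a ^ Suc n - b ^ Suc n) \<le> norm (a - b) * norm (a ^ n) + norm b * norm (a ^ n - b ^ n)"
    by (metis (no_types, lifting) add_mono norm_mult_ineq norm_triangle_le)
  also have "\<dots> \<le> norm (a - b) * R ^ n + R * (real n * R ^ (n - 1) * norm (a - b))"
    using \<open>norm (a ^ n) \<le> R ^ n\<close> assms(2) Suc.IH \<open>R \<ge> 0\<close>
    by (intro add_mono mult_mono) auto
  also have "\<dots> = real (Suc n) * R ^ (Suc n - 1) * norm (a - b)"
    by (cases n) (simp_all add: algebra_simps)
  finally show ?case .
qed simp

lemma norm_exp_minus_1_le:
  fixes a :: "'b::{real_normed_algebra_1, banach}"
  shows "norm (exp a - 1) \<le> norm a * exp (norm a)"
proof -
  have "norm (exp (1 *\<^sub>R a) - exp (0 *\<^sub>R a)) \<le> (norm a * exp (norm a)) * norm (1 - 0 :: real)"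
  proof (rule differentiable_bound[where S = "{0..1}" and f = "\<lambda>t. exp (t *\<^sub>R a)"
        and f' = "\<lambda>t h. h *\<^sub>R (a * exp (t *\<^sub>R a))"])
    fix t :: real assume t: "t \<in> {0..1}"
    show "((\<lambda>t. exp (t *\<^sub>R a)) has_derivative (\<lambda>h. h *\<^sub>R (a * exp (t *\<^sub>R a)))) (at t within {0..1})"
      by (rule has_derivative_at_withinI)
        (rule exp_scaleR_has_vector_derivative_left[unfolded has_vector_derivative_def])
    have "norm (exp (t *\<^sub>R a)) \<le> exp (norm a)"
    proof (rule order_trans[OF norm_exp])
      have "norm (t *\<^sub>R a) \<le> norm a"
        using t by (simp add: mult_left_le_one_le)
      then show "exp (norm (t *\<^sub>R a)) \<le> exp (norm a)"
        by (simp only: exp_le_cancel_iff)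
    qed
    then have "norm (a * exp (t *\<^sub>R a)) \<le> norm a * exp (norm a)"
      by (meson mult_left_mono norm_ge_zero norm_mult_ineq order_trans)
    then show "onorm (\<lambda>h. h *\<^sub>R (a * exp (t *\<^sub>R a))) \<le> norm a * exp (norm a)"
      by (intro onorm_le) (simp add: mult.commute mult_left_mono)
  qed auto
  then show ?thesis by simp
qed

section \<open>Uniqueness for linear differential inequalities\<close>

text \<open>
  A form of Gronwall's lemma. On an interval of length \<open>1/(2(|K|+1))\<close> that starts at a zero of \<open>f\<close>, the
  mean value inequality bounds the maximum of the norm of \<open>f\<close> by half of itself; finitely many such
  intervals exhaust \<open>[0, T]\<close>.
\<close>

lemma zero_if_norm_derivative_le:
  fixes f :: "real \<Rightarrow> 'a::real_normed_vector"
  assumes f: "\<And>t. 0 \<le> t \<Longrightarrow> t \<le> T \<Longrightarrow> (f has_vector_derivative f' t) (at t within {0..T})"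
    and bound: "\<And>t. 0 \<le> t \<Longrightarrow> t \<le> T \<Longrightarrow> norm (f' t) \<le> K * norm (f t)"
    and f0: "f 0 = 0" and t: "0 \<le> t" "t \<le> T"
  shows "f t = 0"
proof -
  define \<delta> where "\<delta> = 1 / (2 * (\<bar>K\<bar> + 1))"
  have "\<delta> > 0" by (simp add: \<delta>_def)
  have cont: "continuous_on {0..T} f"
    using f has_vector_derivative_continuous by (fastforce simp: continuous_on_eq_continuous_within)
  have "\<forall>s. 0 \<le> s \<and> s \<le> T \<and> s \<le> real n * \<delta> \<longrightarrow> f s = 0" for n
  proof (induction n)
    case 0
    then show ?case using f0 by auto
  next
    case (Suc n)
    show ?case
    proof (intro allI impI, elim conjE)
      fix s assume s: "0 \<le> s" "s \<le> T" "s \<le> real (Suc n) * \<delta>"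
      define a where "a = min s (real n * \<delta>)"
      have a: "0 \<le> a" "a \<le> s" "s - a \<le> \<delta>" "f a = 0"
        using Suc.IH s \<open>\<delta> > 0\<close> by (auto simp: a_def algebra_simps min_def)
      have "continuous_on {a..s} (\<lambda>x. norm (f x))"
        using a s by (intro continuous_on_norm continuous_on_subset[OF cont]) auto
      then obtain m where m: "m \<in> {a..s}" "\<And>x. x \<in> {a..s} \<Longrightarrow> norm (f x) \<le> norm (f m)"
        using continuous_attains_sup[of "{a..s}" "\<lambda>x. norm (f x)"] a by auto
      have "norm (f m - f a) \<le> (\<bar>K\<bar> * norm (f m)) * norm (m - a)"
      proof (rule differentiable_bound[where S = "{a..s}" and f' = "\<lambda>x h. h *\<^sub>R f' x"])
        fix x assume x: "x \<in> {a..s}"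
        then have x': "0 \<le> x" "x \<le> T" using a s by auto
        show "(f has_derivative (\<lambda>h. h *\<^sub>R f' x)) (at x within {a..s})"
          using has_vector_derivative_within_subset[OF f[OF x'], of "{a..s}"] a s
          by (auto simp: has_vector_derivative_def)
        have "norm (f' x) \<le> \<bar>K\<bar> * norm (f m)"
          using bound[OF x'] m(2)[OF x] abs_ge_self[of K]
          by (meson abs_ge_zero mult_mono norm_ge_zero order_trans)
        then show "onorm (\<lambda>h. h *\<^sub>R f' x) \<le> \<bar>K\<bar> * norm (f m)"
          by (intro onorm_le) (simp add: mult.commute mult_left_mono)
      qed (use m a in auto)
      also have "\<dots> \<le> (\<bar>K\<bar> * norm (f m)) * \<delta>"
        using m a by (intro mult_left_mono) auto
      also have "\<dots> \<le> norm (f m) / 2"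
        by (simp add: \<delta>_def field_simps)
      finally have "norm (f m) = 0"
        using a(4) by simp
      then show "f s = 0"
        using m(2)[of s] a by auto
    qed
  qed
  moreover obtain n where "t \<le> real n * \<delta>"
    using \<open>\<delta> > 0\<close> by (metis ex_less_of_nat_mult less_imp_le)
  ultimately show ?thesis using t by blast
qed

section \<open>The Banach algebra of operators on an extended space\<close>

text \<open>
  A ring multiplication by composition exists only for endomorphisms, hence a type of their own, on
  which exponentials in a Banach algebra make sense. The factor \<open>\<real>\<close> is the one that the
  faithful representation below requires; it also makes the space nonzero, so that \<open>norm 1 = 1\<close>.
\<close>

typedef (overloaded) 'm operator = "UNIV :: (('m::banach \<times> real) \<Rightarrow>\<^sub>L ('m \<times> real)) set"
  morphisms blinfun_of Operator ..

setup_lifting type_definition_operator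

instantiation operator :: (banach) real_normed_vector
begin

lift_definition zero_operator :: "'a operator" is 0 .
lift_definition plus_operator :: "'a operator \<Rightarrow> 'a operator \<Rightarrow> 'a operator" is "(+)" .
lift_definition minus_operator :: "'a operator \<Rightarrow> 'a operator \<Rightarrow> 'a operator" is "(-)" .
lift_definition uminus_operator :: "'a operator \<Rightarrow> 'a operator" is uminus .
lift_definition scaleR_operator :: "real \<Rightarrow> 'a operator \<Rightarrow> 'a operator" is scaleR .
lift_definition norm_operator :: "'a operator \<Rightarrow> real" is norm .
definition dist_operator :: "'a operator \<Rightarrow> 'a operator \<Rightarrow> real" where
  "dist_operator a b = norm (a - b)"
definition sgn_operator :: "'a operator \<Rightarrow> 'a operator" where
  "sgn_operator a = inverse (norm a) *\<^sub>R a"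
definition uniformity_operator :: "('a operator \<times> 'a operator) filter" where
  "uniformity_operator = (INF e\<in>{0<..}. principal {(x, y). dist x y < e})"
definition open_operator :: "'a operator set \<Rightarrow> bool" where
  "open_operator S = (\<forall>x\<in>S. \<forall>\<^sub>F (x', y) in uniformity. x' = x \<longrightarrow> y \<in> S)"

instance
proof
  fix a b c :: "'a operator" and r s :: real
  show "dist a b = norm (a - b)" by (rule dist_operator_def)
  show "sgn a = inverse (norm a) *\<^sub>R a" by (rule sgn_operator_def)
  show "uniformity = (INF e\<in>{0<..}. principal {(x :: 'a operator, y). dist x y < e})"
    by (rule uniformity_operator_def)
  show "open S = (\<forall>x\<in>S. \<forall>\<^sub>F (x', y) in uniformity. x' = x \<longrightarrow> y \<in> S)" for S :: "'a operator set"
    by (rule open_operator_def)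
  show "a + b + c = a + (b + c)" "a + b = b + a" "0 + a = a" "- a + a = 0" "a - b = a + - b"
    "r *\<^sub>R (a + b) = r *\<^sub>R a + r *\<^sub>R b" "(r + s) *\<^sub>R a = r *\<^sub>R a + s *\<^sub>R a"
    "r *\<^sub>R s *\<^sub>R a = (r * s) *\<^sub>R a" "1 *\<^sub>R a = a"
    by (transfer, simp add: scaleR_add_right scaleR_add_left)+
  show "norm a = 0 \<longleftrightarrow> a = 0" "norm (a + b) \<le> norm a + norm b" "norm (r *\<^sub>R a) = \<bar>r\<bar> * norm a"
    by (transfer, simp add: norm_triangle_ineq)+
qed

end

instantiation operator :: (banach) real_normed_algebra_1
begin

lift_definition one_operator :: "'a operator" is id_blinfun .
lift_definition times_operator :: "'a operator \<Rightarrow> 'a operator \<Rightarrow> 'a operator" is "(o\<^sub>L)" .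

instance
proof
  fix a b c :: "'a operator" and r s :: real
  show "a * b * c = a * (b * c)" "1 * a = a" "a * 1 = a"
    by (transfer, rule blinfun_eqI, simp)+
  show "(a + b) * c = a * c + b * c" "a * (b + c) = a * b + a * c"
    "r *\<^sub>R a * b = r *\<^sub>R (a * b)" "a * r *\<^sub>R b = r *\<^sub>R (a * b)"
    by (transfer, rule blinfun_eqI, simp add: blinfun.bilinear_simps)+
  show "norm (a * b) \<le> norm a * norm b"
    by transfer (rule norm_blinfun_compose)
  show "(0 :: 'a operator) \<noteq> 1"
  proof transfer
    have "blinfun_apply (id_blinfun :: ('a \<times> real) \<Rightarrow>\<^sub>L ('a \<times> real)) (0, 1) \<noteq> blinfun_apply 0 (0, 1)"
      by (simp add: zero_prod_def)
    then show "(0 :: ('a \<times> real) \<Rightarrow>\<^sub>L ('a \<times> real)) \<noteq> id_blinfun"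
      by metis
  qed
  show "norm (1 :: 'a operator) = 1"
  proof transfer
    have "blinfun_apply (id_blinfun :: ('a \<times> real) \<Rightarrow>\<^sub>L ('a \<times> real)) (0, 1) = (0, 1)"
      by simp
    then have "1 \<le> norm (id_blinfun :: ('a \<times> real) \<Rightarrow>\<^sub>L ('a \<times> real))"
      using norm_blinfun[of "id_blinfun :: ('a \<times> real) \<Rightarrow>\<^sub>L ('a \<times> real)" "(0, 1)"]
      by (simp add: norm_Pair)
    then show "norm (id_blinfun :: ('a \<times> real) \<Rightarrow>\<^sub>L ('a \<times> real)) = 1"
      using norm_blinfun_id_le by (rule antisym[rotated])
  qed
qed

end

instance operator :: (banach) banach
proof
  fix X :: "nat \<Rightarrow> 'a operator"
  assume "Cauchy X"
  have dist: "dist (blinfun_of S) (blinfun_of T) = dist S T" for S T :: "'a operator"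
    unfolding dist_norm by transfer simp
  have "Cauchy (\<lambda>n. blinfun_of (X n))"
    using \<open>Cauchy X\<close> by (simp add: Cauchy_def dist)
  then obtain L where L: "(\<lambda>n. blinfun_of (X n)) \<longlonglongrightarrow> L"
    by (auto simp: Cauchy_convergent_iff convergent_def)
  have "X \<longlonglongrightarrow> Operator L"
    using L unfolding tendsto_iff
    by (simp add: dist[symmetric] Operator_inverse)
  then show "convergent X" by (auto simp: convergent_def)
qed

lift_definition op_apply :: "'m::banach operator \<Rightarrow> 'm \<times> real \<Rightarrow> 'm \<times> real" is blinfun_apply .

lemma operator_eqI: "(\<And>v. op_apply S v = op_apply T v) \<Longrightarrow> S = T"
  by transfer (rule blinfun_eqI)

lemma norm_op_apply: "norm (op_apply T v) \<le> norm T * norm v"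
  by transfer (rule norm_blinfun)

lemma op_apply_simps [simp]:
  "op_apply (S * T) v = op_apply S (op_apply T v)"
  "op_apply 1 v = v"
  by (transfer, simp)+

lemma bounded_bilinear_op_apply: "bounded_bilinear op_apply"
proof
  fix S T :: "'m::banach operator" and v w :: "'m \<times> real" and r :: real
  show "op_apply (S + T) v = op_apply S v + op_apply T v"
    "op_apply S (v + w) = op_apply S v + op_apply S w"
    "op_apply (r *\<^sub>R S) v = r *\<^sub>R op_apply S v"
    "op_apply S (r *\<^sub>R v) = r *\<^sub>R op_apply S v"
    by (transfer, simp add: blinfun.bilinear_simps)+
  show "\<exists>K. \<forall>(T :: 'm operator) v. norm (op_apply T v) \<le> norm T * norm v * K"
    by (rule exI[of _ 1]) (simp add: norm_op_apply)
qed

interpretation op_apply: bounded_bilinear op_apply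
  by (rule bounded_bilinear_op_apply)

lemma exists_operator:
  assumes "bounded_linear f"
  shows "\<exists>T. op_apply T = f"
  by (rule exI[of _ "Operator (Blinfun f)"])
    (simp add: op_apply.rep_eq Operator_inverse bounded_linear_Blinfun_apply[OF assms])

lemma norm_operator_le:
  assumes "0 \<le> b" "\<And>v. norm (op_apply T v) \<le> b * norm v"
  shows "norm T \<le> b"
  using assms by transfer (rule norm_blinfun_bound)

section \<open>Graded Banach Lie algebras\<close>

locale graded_algebra =
  fixes G :: "'m::banach graded_structure"
  assumes graded: "graded_banach_lie_algebra G"
begin

abbreviation br :: "'m \<Rightarrow> 'm \<Rightarrow> 'm" where "br \<equiv> bracket G"
abbreviation d :: nat where "d \<equiv> depth G"
abbreviation comp :: "nat \<Rightarrow> 'm \<Rightarrow> 'm" where "comp \<equiv> component G"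

lemma bilinear_bracket: "bounded_bilinear br"
  and bracket_skew: "br x y = - br y x"
  and jacobi: "br x (br y z) + br y (br z x) + br z (br x y) = 0"
  and decomposition: "direct_sum_decomposition G"
  using graded unfolding graded_banach_lie_algebra_def by blast+

sublocale br: bounded_bilinear br
  by (rule bilinear_bracket)

lemma bracket_self [simp]: "br x x = 0"
proof -
  have "br x x + br x x = 0"
    by (metis bracket_skew add.right_inverse)
  then show ?thesis by (simp flip: scaleR_2)
qed

definition ix :: "nat set" where "ix = {1..d}"

lemma finite_ix [simp]: "finite ix"
  and mem_ix: "i \<in> ix \<longleftrightarrow> 1 \<le> i \<and> i \<le> d"
  by (auto simp: ix_def)

lemma bracket_layers:
  assumes "i \<in> ix" "j \<in> ix" "x \<in> layer G i" "y \<in> layer G j"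
  shows "if i + j \<le> d then br x y \<in> layer G (i + j) else br x y = 0"
  using graded assms unfolding graded_banach_lie_algebra_def ix_def by blast

lemma depth_ge_1: "1 \<le> d"
  and subspace_layer: "i \<in> ix \<Longrightarrow> subspace (layer G i)"
  and bij_layer_sum: "bij_betw (layer_sum G) (layer_prod G) UNIV"
  using decomposition unfolding direct_sum_decomposition_def ix_def by blast+

lemma component_prod: "(\<lambda>i. comp i x) \<in> layer_prod G"
  and layer_sum_component: "layer_sum G (\<lambda>i. comp i x) = x"
  using bij_layer_sum
  unfolding bij_betw_def component_def
  by (auto intro!: the_inv_into_into f_the_inv_into_f[where f = "layer_sum G"])

lemma component_in_layer: "i \<in> ix \<Longrightarrow> comp i x \<in> layer G i"
  using component_prod[of x] by (auto simp: layer_prod_def ix_def PiE_iff)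

lemma sum_component: "(\<Sum>i\<in>ix. comp i x) = x"
  using layer_sum_component[of x] by (simp add: layer_sum_def ix_def)

lemma component_eqI:
  assumes "\<And>i. i \<in> ix \<Longrightarrow> s i \<in> layer G i" "(\<Sum>i\<in>ix. s i) = x" "i \<in> ix"
  shows "comp i x = s i"
proof -
  let ?s = "restrict s ix"
  have "?s \<in> layer_prod G" "layer_sum G ?s = x"
    using assms by (auto simp: layer_prod_def layer_sum_def ix_def)
  then have "the_inv_into (layer_prod G) (layer_sum G) x = ?s"
    using bij_layer_sum unfolding bij_betw_def by (metis the_inv_into_f_f)
  then show ?thesis using assms(3) by (simp add: component_def)
qed

lemma linear_component:
  assumes i: "i \<in> ix"
  shows "linear (comp i)"
proof (rule linearI)
  fix x y :: 'm and r :: real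
  show "comp i (x + y) = comp i x + comp i y"
    by (rule component_eqI[where s = "\<lambda>i. comp i x + comp i y"])
      (auto simp: i sum.distrib sum_component intro: subspace_add subspace_layer component_in_layer)
  show "comp i (r *\<^sub>R x) = r *\<^sub>R comp i x"
    by (rule component_eqI[where s = "\<lambda>i. r *\<^sub>R comp i x"])
      (auto simp: i sum_component scaleR_sum_right[symmetric]
        intro: subspace_scale subspace_layer component_in_layer)
qed

lemma bounded_linear_component:
  assumes i: "i \<in> ix"
  shows "bounded_linear (comp i)"
proof -
  obtain c where c: "c > 0" and bd: "\<And>s. s \<in> layer_prod G \<Longrightarrow>
      c * Max ((\<lambda>i. norm (s i)) ` ix) \<le> norm (layer_sum G s)"
    using decomposition unfolding direct_sum_decomposition_def ix_def by blast
  have bound: "norm (comp i x) \<le> norm x * (1 / c)" for x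
  proof -
    have "norm (comp i x) \<le> Max ((\<lambda>i. norm (comp i x)) ` ix)"
      using i by (intro Max_ge) auto
    then have "c * norm (comp i x) \<le> norm x"
      using bd[OF component_prod, of x] c
      by (simp add: layer_sum_component) (meson less_imp_le mult_left_mono order_trans)
    then show ?thesis using c by (simp add: field_simps)
  qed
  show ?thesis
    by (rule bounded_linear_intro[OF linear_add linear_scale bound]) (fact linear_component[OF i])+
qed

lemma component_layer:
  assumes "j \<in> ix" "x \<in> layer G j" "i \<in> ix"
  shows "comp i x = (if i = j then x else 0)"
  by (rule component_eqI[where s = "\<lambda>i. if i = j then x else 0"])
    (use assms in \<open>simp_all add: subspace_0 subspace_layer\<close>)

lemma vector_eqI:
  assumes "\<And>i. i \<in> ix \<Longrightarrow> comp i x = comp i y"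
  shows "x = y"
proof -
  have "(\<Sum>i\<in>ix. comp i x) = (\<Sum>i\<in>ix. comp i y)"
    by (rule sum.cong[OF refl assms])
  then show ?thesis by (simp only: sum_component)
qed

lemma bracket_expand: "br x y = (\<Sum>i\<in>ix. \<Sum>j\<in>ix. br (comp i x) (comp j y))"
proof -
  have "br x y = br (\<Sum>i\<in>ix. comp i x) (\<Sum>j\<in>ix. comp j y)"
    by (simp only: sum_component)
  then show ?thesis
    by (simp only: br.sum_left br.sum_right) (rule sum.swap)
qed

text \<open>
  The dilations and the derivation \<open>weight\<close> both act on each layer by a scalar; their compatibility
  with the bracket comes from the common formula \<open>layer_multiplier_bracket\<close>.
\<close>

definition layer_multiplier :: "(nat \<Rightarrow> real) \<Rightarrow> 'm \<Rightarrow> 'm" where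
  "layer_multiplier c x = (\<Sum>i\<in>ix. c i *\<^sub>R comp i x)"

lemma bounded_linear_layer_multiplier: "bounded_linear (layer_multiplier c)"
  unfolding layer_multiplier_def
  by (rule bounded_linear_sum)
    (rule bounded_linear_compose[OF bounded_linear_scaleR_right bounded_linear_component])

lemma component_layer_multiplier:
  assumes "i \<in> ix"
  shows "comp i (layer_multiplier c x) = c i *\<^sub>R comp i x"
  using assms
  by (intro component_eqI[where s = "\<lambda>i. c i *\<^sub>R comp i x"])
    (auto simp: layer_multiplier_def intro: subspace_scale subspace_layer component_in_layer)

lemma layer_multiplier_layer:
  assumes "i \<in> ix" "x \<in> layer G i"
  shows "layer_multiplier c x = c i *\<^sub>R x"
  using assms
proof -
  have "layer_multiplier c x = (\<Sum>j\<in>ix. if j = i then c i *\<^sub>R x else 0)"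
    unfolding layer_multiplier_def
    by (intro sum.cong refl) (simp add: component_layer[OF assms])
  then show ?thesis using assms by simp
qed

lemma layer_multiplier_bracket_components:
  assumes "i \<in> ix" "j \<in> ix"
  shows "layer_multiplier c (br (comp i x) (comp j y)) = c (i + j) *\<^sub>R br (comp i x) (comp j y)"
  using bracket_layers[OF assms component_in_layer component_in_layer, OF assms, of x y] assms
  by (cases "i + j \<le> d")
    (auto simp: mem_ix layer_multiplier_layer linear_0 bounded_linear.linear[OF bounded_linear_layer_multiplier])

lemma layer_multiplier_bracket:
  "layer_multiplier c (br x y)
    = (\<Sum>i\<in>ix. \<Sum>j\<in>ix. c (i + j) *\<^sub>R br (comp i x) (comp j y))"
proof -
  interpret m: bounded_linear "layer_multiplier c" by (rule bounded_linear_layer_multiplier)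
  show ?thesis
    unfolding bracket_expand[of x y] m.sum
    by (intro sum.cong refl) (rule layer_multiplier_bracket_components)
qed

definition weight :: "'m \<Rightarrow> 'm" where
  "weight = layer_multiplier real"

lemma bounded_linear_weight: "bounded_linear weight"
  unfolding weight_def by (rule bounded_linear_layer_multiplier)

lemma weight_derivation: "weight (br x y) = br (weight x) y + br x (weight y)"
proof -
  have "br (weight x) y + br x (weight y) = (\<Sum>i\<in>ix. \<Sum>j\<in>ix.
      br (comp i (weight x)) (comp j y) + br (comp i x) (comp j (weight y)))"
    by (simp only: sum.distrib bracket_expand[symmetric])
  also have "\<dots> = (\<Sum>i\<in>ix. \<Sum>j\<in>ix. real (i + j) *\<^sub>R br (comp i x) (comp j y))"
    by (intro sum.cong refl)
      (simp add: weight_def component_layer_multiplier br.scaleR_left br.scaleR_right scaleR_add_left)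
  finally show ?thesis
    unfolding weight_def layer_multiplier_bracket by simp
qed

lemma layer_multiplier_inverse:
  assumes "\<And>i. i \<in> ix \<Longrightarrow> c i * c' i = 1"
  shows "layer_multiplier c (layer_multiplier c' x) = x"
  by (rule vector_eqI) (simp add: component_layer_multiplier assms)

lemma norm_le_norm_weight: "\<exists>K>0. \<forall>x. norm x \<le> K * norm (weight x)"
proof -
  obtain K where "K > 0" and "\<And>x. norm (layer_multiplier (\<lambda>i. 1 / real i) x) \<le> norm x * K"
    using bounded_linear.pos_bounded[OF bounded_linear_layer_multiplier] by blast
  moreover have "layer_multiplier (\<lambda>i. 1 / real i) (weight x) = x" for x
    unfolding weight_def by (rule layer_multiplier_inverse) (simp add: mem_ix)
  ultimately have "norm x \<le> K * norm (weight x)" for x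
    by (metis mult.commute)
  then show ?thesis using \<open>K > 0\<close> by blast
qed

lemma dilation_eq_layer_multiplier: "dilation G r = layer_multiplier (\<lambda>i. r ^ i)"
  by (rule ext) (simp only: dilation_def layer_multiplier_def ix_def)

lemma dilation_bracket: "dilation G r (br x y) = br (dilation G r x) (dilation G r y)"
proof -
  let ?c = "\<lambda>i. r ^ i"
  have "br (layer_multiplier ?c x) (layer_multiplier ?c y)
      = (\<Sum>i\<in>ix. \<Sum>j\<in>ix. br (comp i (layer_multiplier ?c x)) (comp j (layer_multiplier ?c y)))"
    by (rule bracket_expand)
  also have "\<dots> = (\<Sum>i\<in>ix. \<Sum>j\<in>ix. r ^ (i + j) *\<^sub>R br (comp i x) (comp j y))"
    by (intro sum.cong refl)
      (simp add: component_layer_multiplier br.scaleR_left br.scaleR_right power_add mult.commute)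
  finally show ?thesis
    by (simp only: dilation_eq_layer_multiplier layer_multiplier_bracket)
qed

lemma component_dilation: "i \<in> ix \<Longrightarrow> comp i (dilation G r x) = r ^ i *\<^sub>R comp i x"
  by (simp add: dilation_eq_layer_multiplier component_layer_multiplier)

lemma linear_dilation: "linear (dilation G r)"
  unfolding dilation_eq_layer_multiplier
  by (rule bounded_linear.linear[OF bounded_linear_layer_multiplier])

text \<open>
  Bracketing raises the filtration by the index of the lowest nonzero component, because every layer
  has index at least 1. Nilpotency of the Lie algebra follows.
\<close>

lemma component_bracket_zero:
  assumes y: "\<And>j. j \<in> ix \<Longrightarrow> j < n \<Longrightarrow> comp j y = 0" and k: "k \<in> ix" "k \<le> n"
  shows "comp k (br x y) = 0"
proof -
  interpret c: linear "comp k" by (rule linear_component[OF k(1)])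
  have "comp k (br (comp i x) (comp j y)) = 0" if ij: "i \<in> ix" "j \<in> ix" for i j
  proof (cases "j < n")
    case False
    then have "i + j \<noteq> k" using ij k by (auto simp: mem_ix)
    then show ?thesis
      using bracket_layers[OF ij component_in_layer component_in_layer, OF ij, of x y] ij k(1)
        component_layer[of "i + j" "br (comp i x) (comp j y)" k]
      by (cases "i + j \<le> d") (auto simp: c.zero mem_ix)
  qed (simp add: y ij br.zero_right c.zero)
  then show ?thesis
    by (subst bracket_expand) (simp add: c.sum cong: sum.cong)
qed

lemma component_lie_word_zero:
  assumes "k \<in> ix" "k < length xs"
  shows "comp k (lie_word G xs) = 0"
  using assms
proof (induction xs arbitrary: k rule: induct_list012)
  case (1 k)
  then show ?case by simp
next
  case (2 x k)
  then show ?case by (simp add: mem_ix)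
next
  case (3 x y zs k)
  then show ?case
    by (auto intro!: component_bracket_zero[of "length (y # zs)"])
qed

lemma lie_word_eq_0:
  assumes "d < length xs"
  shows "lie_word G xs = 0"
  by (rule vector_eqI)
    (use assms in \<open>simp add: component_lie_word_zero linear_0[OF linear_component] mem_ix\<close>)

lemma lie_word_eq_0_step:
  assumes "nilpotency_step G < length xs"
  shows "lie_word G xs = 0"
proof -
  have *: "lie_word G ys = 0" if "length ys = Suc (nilpotency_step G)" for ys
  proof -
    have "\<forall>xs. length xs = Suc d \<longrightarrow> lie_word G xs = 0"
      by (intro allI impI lie_word_eq_0) simp
    then have "\<forall>xs. length xs = Suc (nilpotency_step G) \<longrightarrow> lie_word G xs = 0"
      unfolding nilpotency_step_def by (rule LeastI)
    then show ?thesis using that by blast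
  qed
  show ?thesis
    using assms
  proof (induction xs)
    case (Cons x xs)
    show ?case
    proof (cases "length xs = nilpotency_step G")
      case False
      then have "lie_word G xs = 0" "xs \<noteq> []"
        using Cons by auto
      then show ?thesis by (cases xs) (auto simp: br.zero_right)
    qed (simp add: *)
  qed simp
qed

text \<open>
  Hence the Baker-Campbell-Hausdorff sum may be extended to all degrees up to the depth, whatever the
  step is.
\<close>

lemma nilpotency_step_le_depth: "nilpotency_step G \<le> d"
  unfolding nilpotency_step_def by (rule Least_le) (simp add: lie_word_eq_0)

end

section \<open>A faithful nilpotent representation\<close>

context graded_algebra
begin

text \<open>
  The adjoint action of \<open>x\<close> on the semidirect product of the Lie algebra with the line spanned by the
  derivation \<open>weight\<close>. On the ideal \<open>'m \<times> {0}\<close> it is the adjoint representation; the image of \<open>(0, 1)\<close>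
  recovers \<open>x\<close>, which the adjoint representation alone would not.
\<close>

definition rep :: "'m \<Rightarrow> 'm operator" where
  "rep x = (SOME T. \<forall>u a. op_apply T (u, a) = (br x u - a *\<^sub>R weight x, 0))"

lemma rep_apply: "op_apply (rep x) (u, a) = (br x u - a *\<^sub>R weight x, 0)"
proof -
  have "bounded_linear (\<lambda>v. (br x (fst v) - snd v *\<^sub>R weight x, 0 :: real))"
    by (intro bounded_linear_Pair bounded_linear_sub bounded_linear_zero
        bounded_linear_compose[OF br.bounded_linear_right] bounded_linear_fst
        bounded_linear_compose[OF bounded_linear_scaleR_left] bounded_linear_snd)
  then obtain T where "op_apply T = (\<lambda>v. (br x (fst v) - snd v *\<^sub>R weight x, 0))"
    using exists_operator by blast
  then have "\<forall>u a. op_apply T (u, a) = (br x u - a *\<^sub>R weight x, 0)"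
    by simp
  then show ?thesis
    unfolding rep_def by (rule someI2) blast
qed

sublocale weight: bounded_linear weight
  by (rule bounded_linear_weight)

lemma rep_add: "rep (x + y) = rep x + rep y"
  and rep_scaleR: "rep (r *\<^sub>R x) = r *\<^sub>R rep x"
  by (rule operator_eqI; auto simp: rep_apply op_apply.add_left op_apply.scaleR_left br.add_left
      br.scaleR_left weight.add weight.scaleR algebra_simps)+

lemma bounded_linear_rep: "bounded_linear rep"
proof -
  obtain K where K: "K \<ge> 0" "\<And>a b. norm (br a b) \<le> norm a * norm b * K"
    using br.nonneg_bounded by blast
  obtain M where M: "M \<ge> 0" "\<And>x. norm (weight x) \<le> norm x * M"
    using weight.nonneg_bounded by blast
  have "norm (rep x) \<le> norm x * (K + M)" for x
  proof (rule norm_operator_le)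
    fix v :: "'m \<times> real"
    obtain u a where v: "v = (u, a)" by fastforce
    have "norm (op_apply (rep x) v) \<le> norm (br x u) + norm (a *\<^sub>R weight x)"
      using norm_triangle_ineq4[of "br x u" "a *\<^sub>R weight x"] by (simp add: v rep_apply norm_Pair)
    also have "\<dots> \<le> norm x * norm v * K + norm v * (norm x * M)"
    proof (rule add_mono)
      have "norm u \<le> norm v" "norm a \<le> norm v"
        unfolding v by (metis fst_conv norm_fst_le, metis snd_conv norm_snd_le)
      then show "norm (br x u) \<le> norm x * norm v * K"
        using K by (meson K(2) mult_left_mono mult_right_mono norm_ge_zero order_trans)
      show "norm (a *\<^sub>R weight x) \<le> norm v * (norm x * M)"
        using M(2)[of x] \<open>norm a \<le> norm v\<close> by (auto intro!: mult_mono)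
    qed
    also have "\<dots> = norm x * (K + M) * norm v"
      by (simp add: algebra_simps)
    finally show "norm (op_apply (rep x) v) \<le> norm x * (K + M) * norm v" .
  qed (use K M in auto)
  then show ?thesis
    by (intro bounded_linear_intro rep_add rep_scaleR)
qed

sublocale rep: bounded_linear rep
  by (rule bounded_linear_rep)

lemma rep_bracket: "rep (br x y) = commutator (rep x) (rep y)"
proof (rule operator_eqI)
  fix v :: "'m \<times> real"
  obtain u a where v: "v = (u, a)" by fastforce
  have J: "br (br x y) u = br x (br y u) - br y (br x u)"
    using jacobi[of x y u] bracket_skew[of "br x y" u] bracket_skew[of u x]
    by (simp add: br.minus_right algebra_simps add_eq_0_iff)
  have D: "weight (br x y) = br x (weight y) - br y (weight x)"
    using weight_derivation[of x y] bracket_skew[of "weight x" y] by simp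
  show "op_apply (rep (br x y)) v = op_apply (commutator (rep x) (rep y)) v"
    by (simp add: v commutator_def op_apply.diff_left rep_apply J D br.diff_right br.scaleR_right
        scaleR_diff_right)
qed

lemma norm_le_norm_rep: "\<exists>K>0. \<forall>x. norm x \<le> K * norm (rep x)"
proof -
  obtain K where K: "K > 0" "\<And>x. norm x \<le> K * norm (weight x)"
    using norm_le_norm_weight by blast
  have "norm (weight x) \<le> norm (rep x)" for x
    using norm_op_apply[of "rep x" "(0, 1)"]
    by (simp add: rep_apply br.zero_right norm_Pair)
  then show ?thesis
    using K by (meson less_imp_le mult_left_mono order_trans)
qed

lemma rep_inject: "rep x = rep y \<longleftrightarrow> x = y"
proof
  assume "rep x = rep y"
  then have "rep (x - y) = 0" by (simp add: rep.diff)
  then show "x = y"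
    using norm_le_norm_rep by (metis eq_iff_diff_eq_0 mult_zero_right norm_le_zero_iff norm_zero)
qed simp

abbreviation emb :: "'m \<Rightarrow> 'm \<times> real" where
  "emb u \<equiv> (u, 0)"

lemma rep_emb: "op_apply (rep x) (emb u) = emb (br x u)"
  by (simp add: rep_apply)

lemma rep_power_emb: "op_apply (rep x ^ k) (emb u) = emb ((br x ^^ k) u)"
  by (induction k) (simp_all add: rep_emb)

lemma bounded_linear_emb: "bounded_linear emb"
  by (intro bounded_linear_Pair bounded_linear_ident bounded_linear_zero)

sublocale emb: bounded_linear emb
  by (rule bounded_linear_emb)

lemma lie_word_Cons: "w \<noteq> [] \<Longrightarrow> lie_word G (x # w) = br x (lie_word G w)"
  by (cases w) auto

lemma lie_word_replicate_append:
  "w \<noteq> [] \<Longrightarrow> lie_word G (replicate n x @ w) = (br x ^^ n) (lie_word G w)"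
  by (induction n) (simp_all add: lie_word_Cons)

lemma bracket_power_zero: "d \<le> k \<Longrightarrow> (br x ^^ k) y = 0"
  using lie_word_replicate_append[of "[y]" k x] lie_word_eq_0[of "replicate k x @ [y]"] by simp

lemma rep_nilpotent: "rep x ^ Suc d = 0"
proof (rule operator_eqI)
  fix v :: "'m \<times> real"
  obtain u a where v: "v = (u, a)" by fastforce
  have "op_apply (rep x ^ Suc d) v = op_apply (rep x ^ d) (emb (br x u - a *\<^sub>R weight x))"
    by (simp only: v power_Suc2 op_apply_simps rep_apply)
  also have "\<dots> = 0"
    by (simp only: rep_power_emb bracket_power_zero[OF order_refl] emb.zero)
  finally show "op_apply (rep x ^ Suc d) v = op_apply 0 v"
    by (simp only: op_apply.zero_left)
qed

lemma commutator_power_rep: "(commutator (rep x) ^^ k) (rep y) = rep ((br x ^^ k) y)"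
  by (induction k) (simp_all add: rep_bracket)

lemma commutator_power_rep_zero: "Suc d \<le> k \<Longrightarrow> (commutator (rep x) ^^ k) (rep y) = 0"
  by (simp add: commutator_power_rep bracket_power_zero rep.zero)

section \<open>The Dynkin series as a differential equation\<close>

definition dynkin_word :: "'m \<Rightarrow> 'm \<Rightarrow> (nat \<times> nat) list \<Rightarrow> 'm list" where
  "dynkin_word x y ps = concat (map (\<lambda>(r, s). replicate r x @ replicate s y) ps)"

definition dynkin_degree :: "(nat \<times> nat) list \<Rightarrow> nat" where
  "dynkin_degree ps = (\<Sum>(r, s)\<leftarrow>ps. r + s)"

definition dynkin_fact :: "(nat \<times> nat) list \<Rightarrow> real" where
  "dynkin_fact ps = (\<Prod>(r, s)\<leftarrow>ps. fact r * fact s)"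

lemma dynkin_simps [simp]:
  "dynkin_word x y [] = []"
  "dynkin_word x y ((r, s) # ps) = replicate r x @ replicate s y @ dynkin_word x y ps"
  "dynkin_degree [] = 0"
  "dynkin_degree ((r, s) # ps) = r + s + dynkin_degree ps"
  "dynkin_fact [] = 1"
  "dynkin_fact ((r, s) # ps) = fact r * fact s * dynkin_fact ps"
  by (simp_all add: dynkin_word_def dynkin_degree_def dynkin_fact_def)

lemma length_dynkin_word: "length (dynkin_word x y ps) = dynkin_degree ps"
  by (induction ps) auto

lemma bch_part_eq:
  "bch_part G m x y = (\<Sum>k = 1..m. \<Sum>ps\<in>dynkin_indices k m.
     ((- 1) ^ (k - 1) / (real k * real m * dynkin_fact ps)) *\<^sub>R lie_word G (dynkin_word x y ps))"
  unfolding bch_part_def dynkin_word_def dynkin_fact_def by simp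

lemma dynkin_indices_eq:
  "dynkin_indices k m = {ps. length ps = k \<and> (0, 0) \<notin> set ps \<and> dynkin_degree ps = m}"
proof -
  have "(\<forall>(r, s)\<in>set ps. r + s > 0) \<longleftrightarrow> (0, 0) \<notin> set ps" for ps :: "(nat \<times> nat) list"
    by (induction ps) auto
  then show ?thesis
    unfolding dynkin_indices_def dynkin_degree_def by simp
qed

lemma dynkin_degree_ge_length: "(0, 0) \<notin> set ps \<Longrightarrow> length ps \<le> dynkin_degree ps"
proof (induction ps)
  case (Cons p ps)
  then show ?case by (cases p) (auto simp: Suc_le_eq add_pos_nonneg)
qed simp

lemma dynkin_degree_ge: "(r, s) \<in> set ps \<Longrightarrow> r + s \<le> dynkin_degree ps"
  by (induction ps) auto

text \<open>
  An exponent above the depth only produces words that vanish. Lists over this finite set are easier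
  to sum over than Dynkin's index sets, since they arise by expanding a power of
  \<open>exp (t x) exp (t y) - 1\<close>.
\<close>

definition exponent_pairs :: "(nat \<times> nat) set" where
  "exponent_pairs = {..d} \<times> {..d} - {(0, 0)}"

definition exponent_lists :: "nat \<Rightarrow> (nat \<times> nat) list set" where
  "exponent_lists k = {ps. set ps \<subseteq> exponent_pairs \<and> length ps = k}"

lemma finite_exponent_pairs [simp]: "finite exponent_pairs"
  by (simp add: exponent_pairs_def)

lemma finite_exponent_lists [simp]: "finite (exponent_lists k)"
  unfolding exponent_lists_def by (rule finite_lists_length_eq) simp

lemma exponent_lists_degree: "ps \<in> exponent_lists (Suc k) \<Longrightarrow> 1 \<le> dynkin_degree ps"
proof -
  assume ps: "ps \<in> exponent_lists (Suc k)"
  then have "(0, 0) \<notin> set ps" by (auto simp: exponent_lists_def exponent_pairs_def)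
  then show ?thesis
    using dynkin_degree_ge_length[of ps] ps by (simp add: exponent_lists_def)
qed

text \<open>
  The derivative in \<open>t\<close> of the part of Dynkin's series with \<open>k + 1\<close> factors, without the coefficient
  \<open>(-1)\<^sup>k/(k+1)\<close>: differentiating \<open>t\<^sup>m\<close> cancels the denominator \<open>m\<close> of Dynkin's formula. The exponent
  \<open>dynkin_degree ps - 1\<close> is a true difference, as the lists are nonempty and avoid \<open>(0, 0)\<close>.
\<close>

definition dynkin_sum :: "'m \<Rightarrow> 'm \<Rightarrow> real \<Rightarrow> nat \<Rightarrow> 'm" where
  "dynkin_sum x y t k = (\<Sum>ps\<in>exponent_lists (Suc k).
     (t ^ (dynkin_degree ps - 1) / dynkin_fact ps) *\<^sub>R lie_word G (dynkin_word x y ps))"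

lemma dynkin_sum_eq_sum_degrees:
  "dynkin_sum x y t k = (\<Sum>m=1..d. \<Sum>ps\<in>dynkin_indices (Suc k) m.
     (t ^ (m - 1) / dynkin_fact ps) *\<^sub>R lie_word G (dynkin_word x y ps))"
proof -
  let ?h = "\<lambda>ps. (t ^ (dynkin_degree ps - 1) / dynkin_fact ps) *\<^sub>R lie_word G (dynkin_word x y ps)"
  let ?S = "{ps \<in> exponent_lists (Suc k). dynkin_degree ps \<le> d}"
  have "dynkin_sum x y t k = sum ?h ?S"
    unfolding dynkin_sum_def
    by (rule sum.mono_neutral_right) (auto simp: length_dynkin_word lie_word_eq_0)
  also have "\<dots> = (\<Sum>m=1..d. \<Sum>ps\<in>{ps \<in> ?S. dynkin_degree ps = m}. ?h ps)"
  proof (rule sum.group[symmetric])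
    show "dynkin_degree ` ?S \<subseteq> {1..d}"
      using exponent_lists_degree by auto
  qed auto
  also have "\<dots> = (\<Sum>m=1..d. \<Sum>ps\<in>dynkin_indices (Suc k) m. ?h ps)"
  proof (intro sum.cong refl)
    fix m assume m: "m \<in> {1..d}"
    have "r \<le> d \<and> s \<le> d" if "(r, s) \<in> set ps" "dynkin_degree ps = m" for r s ps
      using dynkin_degree_ge[OF that(1)] that(2) m by auto
    then show "{ps \<in> ?S. dynkin_degree ps = m} = dynkin_indices (Suc k) m"
      using m by (auto simp: dynkin_indices_eq exponent_lists_def exponent_pairs_def)
  qed
  finally show ?thesis
    by (simp add: dynkin_indices_eq)
qed

lemma exp_rep: "exp (t *\<^sub>R rep x) = (\<Sum>r\<le>d. (t ^ r / fact r) *\<^sub>R rep x ^ r)"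
  by (subst exp_nilpotent[of _ "Suc d" "Suc d"])
    (simp_all add: rep_nilpotent lessThan_Suc_atMost scaleR_power del: power_Suc)

lemma exp_times_exp_minus_1:
  "exp (t *\<^sub>R rep x) * exp (t *\<^sub>R rep y) - 1
    = (\<Sum>(r, s)\<in>exponent_pairs. (t ^ (r + s) / (fact r * fact s)) *\<^sub>R (rep x ^ r * rep y ^ s))"
proof -
  let ?h = "\<lambda>(r, s). (t ^ (r + s) / (fact r * fact s)) *\<^sub>R (rep x ^ r * rep y ^ s)"
  have "exp (t *\<^sub>R rep x) * exp (t *\<^sub>R rep y) = (\<Sum>r\<le>d. \<Sum>s\<le>d. ?h (r, s))"
    by (simp add: exp_rep sum_product power_add mult.commute)
  also have "\<dots> = sum ?h ({..d} \<times> {..d})"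
    by (simp add: sum.cartesian_product)
  also have "\<dots> = ?h (0, 0) + sum ?h exponent_pairs"
    unfolding exponent_pairs_def by (rule sum.remove) auto
  finally show ?thesis by simp
qed

text \<open>
  Only two kinds of words survive among those with a single pair of exponents: \<open>x\<close> itself, and the
  words with \<open>y\<close> once at the end, which add up to \<open>exp (t ad x) y\<close>. Since \<open>[y, y] = 0\<close>, the factor
  \<open>exp (t ad y)\<close> may be inserted.
\<close>

lemma dynkin_sum_0:
  "emb (dynkin_sum x y t 0)
    = emb x + op_apply (exp (t *\<^sub>R rep x) * exp (t *\<^sub>R rep y)) (emb y)"
proof -
  let ?f = "\<lambda>(r, s). (t ^ (r + s - 1) / (fact r * fact s)) *\<^sub>R lie_word G (replicate r x @ replicate s y)"
  let ?g = "\<lambda>(r, s). (if s = 1 then (t ^ r / fact r) *\<^sub>R (br x ^^ r) y else 0)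
    + (if r = 1 \<and> s = 0 then x else 0)"
  have lists: "exponent_lists (Suc 0) = (\<lambda>p. [p]) ` exponent_pairs"
    by (auto simp: exponent_lists_def length_Suc_conv)
  have pow_zero: "(br z ^^ n) 0 = 0" for z n
    by (induction n) (simp_all add: br.zero_right)
  have power0: "(br z ^^ n) z = 0" if "n > 0" for z n
    using that pow_zero by (auto simp: gr0_conv_Suc funpow_Suc_right simp del: funpow.simps)
  have word: "lie_word G (replicate r x @ replicate (Suc s) y) = (br x ^^ r) ((br y ^^ s) y)" for r s
    using lie_word_replicate_append[of "replicate s y @ [y]" r x]
      lie_word_replicate_append[of "[y]" s y]
    by (simp add: replicate_append_same)
  have word0: "lie_word G (replicate (Suc r) x) = (br x ^^ r) x" for r
    using lie_word_replicate_append[of "[x]" r x] by (simp add: replicate_append_same)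
  have fg: "?f (r, s) = ?g (r, s)" for r s
  proof (cases s)
    case 0
    then show ?thesis
      using word0 power0 by (cases r) (auto simp: gr0_conv_Suc)
  next
    case (Suc s')
    then show ?thesis
      using power0[of s' y] word[of r s'] by (cases "s' = 0") (auto simp: pow_zero)
  qed
  have "dynkin_sum x y t 0 = sum ?f exponent_pairs"
    unfolding dynkin_sum_def lists
    by (subst sum.reindex) (auto simp: inj_on_def intro!: sum.cong)
  also have "\<dots> = sum ?f ({..d} \<times> {..d})"
    unfolding exponent_pairs_def by (rule sum.mono_neutral_left) auto
  also have "\<dots> = (\<Sum>r\<le>d. \<Sum>s\<le>d. ?g (r, s))"
    by (simp only: sum.cartesian_product) (intro sum.cong refl, use fg in auto)
  also have "\<dots> = (\<Sum>r\<le>d. (t ^ r / fact r) *\<^sub>R (br x ^^ r) y) + x"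
  proof -
    have "(\<Sum>s\<le>d. ?g (r, s)) = (t ^ r / fact r) *\<^sub>R (br x ^^ r) y + (if r = 1 then x else 0)" for r
      using depth_ge_1 by (simp add: sum.distrib)
    then show ?thesis
      using depth_ge_1 by (simp add: sum.distrib)
  qed
  finally have eq: "dynkin_sum x y t 0 = (\<Sum>r\<le>d. (t ^ r / fact r) *\<^sub>R (br x ^^ r) y) + x" .
  have "(t ^ r / fact r) *\<^sub>R op_apply (rep y ^ r) (emb y) = (if r = 0 then emb y else 0)" for r
    using power0[of r y] by (auto simp: rep_power_emb)
  then have fix_y: "op_apply (exp (t *\<^sub>R rep y)) (emb y) = emb y"
    by (simp add: exp_rep op_apply.sum_left op_apply.scaleR_left)
  have "emb (dynkin_sum x y t 0) = emb x + (\<Sum>r\<le>d. (t ^ r / fact r) *\<^sub>R emb ((br x ^^ r) y))"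
    unfolding eq emb.add emb.sum emb.scaleR by (rule add.commute)
  also have "(\<Sum>r\<le>d. (t ^ r / fact r) *\<^sub>R emb ((br x ^^ r) y)) = op_apply (exp (t *\<^sub>R rep x)) (emb y)"
    unfolding exp_rep op_apply.sum_left op_apply.scaleR_left rep_power_emb ..
  also have "\<dots> = op_apply (exp (t *\<^sub>R rep x) * exp (t *\<^sub>R rep y)) (emb y)"
    by (simp only: op_apply_simps fix_y)
  finally show ?thesis .
qed

text \<open>
  Prefixing a word by \<open>x\<^sup>r y\<^sup>s\<close> applies \<open>(ad x)\<^sup>r (ad y)\<^sup>s\<close> to its value, and the sum over all nonzero pairs
  of exponents is \<open>exp (t ad x) exp (t ad y) - 1\<close>.
\<close>

lemma dynkin_sum_Suc:
  "emb (dynkin_sum x y t (Suc k))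
    = op_apply (exp (t *\<^sub>R rep x) * exp (t *\<^sub>R rep y) - 1) (emb (dynkin_sum x y t k))"
proof -
  let ?h = "\<lambda>ps. (t ^ (dynkin_degree ps - 1) / dynkin_fact ps) *\<^sub>R emb (lie_word G (dynkin_word x y ps))"
  have lists: "exponent_lists (Suc (Suc k))
      = (\<lambda>(p, ps). p # ps) ` (exponent_pairs \<times> exponent_lists (Suc k))"
    by (auto simp: exponent_lists_def length_Suc_conv image_iff)
  have inj: "inj_on (\<lambda>(p, ps). p # ps) (exponent_pairs \<times> exponent_lists (Suc k))"
    by (auto simp: inj_on_def)
  have emb_sum: "emb (dynkin_sum x y t n) = (\<Sum>ps\<in>exponent_lists (Suc n). ?h ps)" for n
    by (simp add: dynkin_sum_def emb.sum emb.scaleR del: scaleR_Pair)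
  have "emb (dynkin_sum x y t (Suc k))
      = (\<Sum>p\<in>exponent_pairs. \<Sum>ps\<in>exponent_lists (Suc k). ?h (p # ps))"
    unfolding emb_sum lists sum.reindex[OF inj] sum.cartesian_product
    by (intro sum.cong) auto
  also have "\<dots> = (\<Sum>p\<in>exponent_pairs. \<Sum>ps\<in>exponent_lists (Suc k).
      (case p of (r, s) \<Rightarrow> (t ^ (r + s) / (fact r * fact s)) *\<^sub>R op_apply (rep x ^ r * rep y ^ s) (?h ps)))"
  proof (intro sum.cong refl)
    fix p ps assume p: "p \<in> exponent_pairs" and ps: "ps \<in> exponent_lists (Suc k)"
    obtain r s where rs: "p = (r, s)" by fastforce
    have deg: "1 \<le> dynkin_degree ps"
      using ps by (rule exponent_lists_degree)
    then have ne: "dynkin_word x y ps \<noteq> []"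
      using length_dynkin_word[of x y ps] by auto
    have "lie_word G (dynkin_word x y (p # ps))
        = (br x ^^ r) ((br y ^^ s) (lie_word G (dynkin_word x y ps)))"
      using ne by (simp add: rs lie_word_replicate_append)
    moreover have "t ^ (dynkin_degree (p # ps) - 1) = t ^ (r + s) * t ^ (dynkin_degree ps - 1)"
      using deg by (simp add: rs flip: power_add)
    ultimately show "?h (p # ps) = (case p of (r, s) \<Rightarrow>
        (t ^ (r + s) / (fact r * fact s)) *\<^sub>R op_apply (rep x ^ r * rep y ^ s) (?h ps))"
      by (simp add: rs op_apply.scaleR_right rep_power_emb del: scaleR_Pair)
  qed
  also have "\<dots> = op_apply (exp (t *\<^sub>R rep x) * exp (t *\<^sub>R rep y) - 1) (emb (dynkin_sum x y t k))"
    unfolding exp_times_exp_minus_1 emb_sum op_apply.sum_left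
    by (intro sum.cong refl) (auto simp: op_apply.scaleR_left op_apply.sum_right scaleR_sum_right)
  finally show ?thesis .
qed

definition bch_path :: "'m \<Rightarrow> 'm \<Rightarrow> real \<Rightarrow> 'm" where
  "bch_path x y t = (\<Sum>m=1..d. t ^ m *\<^sub>R bch_part G m x y)"

definition bch_velocity :: "'m \<Rightarrow> 'm \<Rightarrow> real \<Rightarrow> 'm" where
  "bch_velocity x y t = (\<Sum>m=1..d. (real m * t ^ (m - 1)) *\<^sub>R bch_part G m x y)"

text \<open>
  The power series of \<open>log T/(T - 1)\<close>, cut off where it ends for the unipotent operators in question.
\<close>

definition log_quotient :: "'m operator \<Rightarrow> 'm operator" where
  "log_quotient T = (\<Sum>k<Suc d. ((- 1) ^ k / real (Suc k)) *\<^sub>R (T - 1) ^ k)"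

lemma bch_velocity_eq_dynkin_sums:
  "bch_velocity x y t = (\<Sum>k<Suc d. ((- 1) ^ k / real (Suc k)) *\<^sub>R dynkin_sum x y t k)"
proof -
  let ?w = "\<lambda>ps. lie_word G (dynkin_word x y ps)"
  let ?T = "\<lambda>m k. \<Sum>ps\<in>dynkin_indices (Suc k) m.
    ((- 1) ^ k / real (Suc k) * (t ^ (m - 1) / dynkin_fact ps)) *\<^sub>R ?w ps"
  have "(\<Sum>k<Suc d. ((- 1) ^ k / real (Suc k)) *\<^sub>R dynkin_sum x y t k)
      = (\<Sum>k<Suc d. \<Sum>m=1..d. ?T m k)"
    by (simp only: dynkin_sum_eq_sum_degrees scaleR_sum_right scaleR_scaleR)
  also have "\<dots> = (\<Sum>m=1..d. \<Sum>k<Suc d. ?T m k)"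
    by (rule sum.swap)
  also have "\<dots> = (\<Sum>m=1..d. (real m * t ^ (m - 1)) *\<^sub>R bch_part G m x y)"
  proof (intro sum.cong refl)
    fix m assume m: "m \<in> {1..d}"
    have "dynkin_indices (Suc k) m = {}" if "m \<le> k" for k
      using that dynkin_degree_ge_length by (fastforce simp: dynkin_indices_eq)
    then have "(\<Sum>k<Suc d. ?T m k) = (\<Sum>k<m. ?T m k)"
      using m by (intro sum.mono_neutral_right) (auto simp: not_less)
    also have "\<dots> = (\<Sum>k<m. \<Sum>ps\<in>dynkin_indices (Suc k) m.
        (real m * t ^ (m - 1)) *\<^sub>R (((- 1) ^ k / (real (Suc k) * real m * dynkin_fact ps)) *\<^sub>R ?w ps))"
    proof (intro sum.cong refl)
      fix k ps
      have "(- 1) ^ k / real (Suc k) * (t ^ (m - 1) / c)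
          = real m * t ^ (m - 1) * ((- 1) ^ k / (real (Suc k) * real m * c))" for c
        using m by simp
      then show "((- 1) ^ k / real (Suc k) * (t ^ (m - 1) / dynkin_fact ps)) *\<^sub>R ?w ps
          = (real m * t ^ (m - 1)) *\<^sub>R (((- 1) ^ k / (real (Suc k) * real m * dynkin_fact ps)) *\<^sub>R ?w ps)"
        by (simp only: scaleR_scaleR)
    qed
    also have "\<dots> = (real m * t ^ (m - 1)) *\<^sub>R bch_part G m x y"
      unfolding bch_part_eq One_nat_def sum.atLeast1_atMost_eq by (simp add: scaleR_sum_right)
    finally show "(\<Sum>k<Suc d. ?T m k) = (real m * t ^ (m - 1)) *\<^sub>R bch_part G m x y" .
  qed
  finally show ?thesis
    by (simp add: bch_velocity_def)
qed

text \<open>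
  The differential equation behind Dynkin's formula.
\<close>

lemma emb_bch_velocity:
  defines "E \<equiv> \<lambda>x y t. exp (t *\<^sub>R rep x) * exp (t *\<^sub>R rep y)"
  shows "emb (bch_velocity x y t)
    = op_apply (log_quotient (E x y t)) (emb x + op_apply (E x y t) (emb y))"
proof -
  have "emb (dynkin_sum x y t k) = op_apply ((E x y t - 1) ^ k) (emb x + op_apply (E x y t) (emb y))" for k
    by (induction k) (simp_all add: E_def dynkin_sum_0 dynkin_sum_Suc del: op_apply_simps(1) add_Pair, simp_all)
  then show ?thesis
    unfolding bch_velocity_eq_dynkin_sums log_quotient_def
    by (simp add: emb.sum emb.scaleR op_apply.sum_left op_apply.scaleR_left
        del: scaleR_Pair add_Pair sum.lessThan_Suc)
qed

lemma bch_path_has_derivative: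
  "(bch_path x y has_vector_derivative bch_velocity x y t) (at t within S)"
  unfolding bch_path_def bch_velocity_def
proof (rule has_vector_derivative_sum)
  fix m
  have "((\<lambda>t. t ^ m) has_real_derivative real m * t ^ (m - 1)) (at t within S)"
    by (auto intro!: derivative_eq_intros)
  then show "((\<lambda>t. t ^ m *\<^sub>R bch_part G m x y) has_vector_derivative
      (real m * t ^ (m - 1)) *\<^sub>R bch_part G m x y) (at t within S)"
    by (intro has_vector_derivative_scaleR[THEN has_vector_derivative_eq_rhs])
      (auto intro!: derivative_eq_intros)
qed

lemma bch_part_1: "bch_part G 1 x y = x + y"
proof -
  have "length ps = 1 \<and> (0, 0) \<notin> set ps \<and> dynkin_degree ps = 1 \<longleftrightarrow> ps = [(1, 0)] \<or> ps = [(0, 1)]" for ps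
    by (auto simp: length_Suc_conv add_is_1)
  then have "dynkin_indices 1 1 = {[(1, 0)], [(0, 1)]}"
    unfolding dynkin_indices_eq by auto
  then show ?thesis by (simp add: bch_part_eq)
qed

lemma bch_part_zero: "nilpotency_step G < m \<Longrightarrow> bch_part G m x y = 0"
  unfolding bch_part_eq
  by (intro sum.neutral ballI) (simp add: dynkin_indices_eq lie_word_eq_0_step length_dynkin_word)

lemma bch_path_1: "bch_path x y 1 = gmult G x y"
proof -
  have "bch_path x y 1 = bch_part G 1 x y + (\<Sum>m=2..d. bch_part G m x y)"
    unfolding bch_path_def using depth_ge_1
    by (subst sum.atLeast_Suc_atMost) (auto simp: numeral_2_eq_2)
  also have "(\<Sum>m=2..d. bch_part G m x y) = (\<Sum>m=2..nilpotency_step G. bch_part G m x y)"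
    using nilpotency_step_le_depth
    by (intro sum.mono_neutral_right) (auto simp: bch_part_zero)
  finally show ?thesis
    by (simp add: gmult_def bch_part_1[unfolded One_nat_def] )
qed

lemma bch_path_0: "bch_path x y 0 = 0"
  unfolding bch_path_def by (intro sum.neutral) auto

end

section \<open>The Baker-Campbell-Hausdorff theorem\<close>

lemma bounded_continuous_on_interval:
  fixes f :: "real \<Rightarrow> 'b::real_normed_vector"
  assumes "continuous_on {0..1} f"
  shows "\<exists>R\<ge>0. \<forall>t\<in>{0..1}. norm (f t) \<le> R"
proof -
  have "bounded (f ` {0..1})"
    using assms by (intro compact_imp_bounded compact_continuous_image) auto
  then obtain R where "\<forall>t\<in>{0..1}. norm (f t) \<le> R"
    by (auto simp: bounded_iff)
  then show ?thesis by (metis atLeastAtMost_iff norm_ge_zero order_refl order_trans zero_le_one)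
qed

context graded_algebra
begin

lemma norm_log_quotient_diff_le:
  assumes "norm S \<le> R" "norm T \<le> R"
  shows "norm (log_quotient S - log_quotient T)
    \<le> (\<Sum>k<Suc d. real k * (R + 1) ^ (k - 1)) * norm (S - T)"
proof -
  have R1: "norm (U - 1) \<le> R + 1" if "norm U \<le> R" for U :: "'m operator"
    using norm_triangle_ineq4[of U 1] that by simp
  have "log_quotient S - log_quotient T
      = (\<Sum>k<Suc d. ((- 1) ^ k / real (Suc k)) *\<^sub>R ((S - 1) ^ k - (T - 1) ^ k))"
    by (simp only: log_quotient_def scaleR_diff_right sum_subtractf)
  also have "norm \<dots> \<le> (\<Sum>k<Suc d. real k * (R + 1) ^ (k - 1) * norm (S - T))"
  proof (rule sum_norm_le)
    fix k
    have "norm (((- 1) ^ k / real (Suc k)) *\<^sub>R ((S - 1) ^ k - (T - 1) ^ k))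
        \<le> 1 * norm ((S - 1) ^ k - (T - 1) ^ k)"
      unfolding norm_scaleR by (rule mult_right_mono) (auto simp: abs_mult power_abs field_simps)
    also have "\<dots> \<le> real k * (R + 1) ^ (k - 1) * norm (S - T)"
      using norm_power_diff_le[OF R1[OF assms(1)] R1[OF assms(2)], of k] by simp
    finally show "norm (((- 1) ^ k / real (Suc k)) *\<^sub>R ((S - 1) ^ k - (T - 1) ^ k))
        \<le> real k * (R + 1) ^ (k - 1) * norm (S - T)" .
  qed
  finally show ?thesis by (simp only: sum_distrib_right)
qed

text \<open>
  Let \<open>W t = exp (rep (Z t))\<close> and \<open>E t = exp (t rep x) exp (t rep y)\<close>, where \<open>Z\<close> is the path of the series.
  Both start at \<open>1\<close>, and \<open>E' = rep x E + E rep y\<close>. For \<open>W\<close> one finds \<open>W' = rep x W + W rep y + rep e W\<close>, where the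
  defect \<open>e\<close> measures that the velocity of \<open>Z\<close> is \<open>q(E)(x + E y)\<close> instead of \<open>q(W)(x + W y)\<close>. Hence \<open>e\<close>
  is at most a multiple of \<open>W - E\<close>, and \<open>zero_if_norm_derivative_le\<close> applies to \<open>W - E\<close>.
\<close>

lemma exp_rep_gmult: "exp (rep (gmult G x y)) = exp (rep x) * exp (rep y)"
proof -
  define Z where "Z = bch_path x y"
  define z where "z = bch_velocity x y"
  define X where "X = rep x"
  define Y where "Y = rep y"
  define E where "E t = exp (t *\<^sub>R X) * exp (t *\<^sub>R Y)" for t
  define W where "W t = exp (rep (Z t))" for t
  \<comment> \<open>\<open>u\<close> and \<open>w\<close> are \<open>\<phi>(ad Z) z\<close> and \<open>e\<^bsup>ad Z\<^esup> y\<close>, the vectors with \<open>W' = rep u W\<close> and \<open>W rep y = rep w W\<close>\<close>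
  define \<phi> where "\<phi> t = (\<Sum>k<Suc d. (1 / fact (Suc k)) *\<^sub>R rep (Z t) ^ k)" for t
  define u where "u t = (\<Sum>k<Suc d. (1 / fact (Suc k)) *\<^sub>R (br (Z t) ^^ k) (z t))" for t
  define w where "w t = (\<Sum>k<Suc d. (1 / fact k) *\<^sub>R (br (Z t) ^^ k) y)" for t
  have Z': "((\<lambda>t. rep (Z t)) has_vector_derivative rep (z t)) (at t within {0..1})" for t
    unfolding Z_def z_def
    by (rule rep.has_vector_derivative[OF bch_path_has_derivative])
  have W': "(W has_vector_derivative rep (u t) * W t) (at t within {0..1})" for t
    using has_vector_derivative_exp_nilpotent[OF Z' rep_nilpotent commutator_power_rep_zero]
    unfolding W_def u_def rep.sum rep.scaleR commutator_power_rep .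
  have WY: "W t * Y = rep (w t) * W t" for t
    using exp_times_eq_sum_commutators[of "Suc d" "rep (Z t)" "rep y", OF commutator_power_rep_zero]
    unfolding W_def Y_def w_def rep.sum rep.scaleR commutator_power_rep .
  have E': "(E has_vector_derivative X * E t + E t * Y) (at t within {0..1})" for t
  proof -
    have "(E has_vector_derivative exp (t *\<^sub>R X) * (exp (t *\<^sub>R Y) * Y) + (X * exp (t *\<^sub>R X)) * exp (t *\<^sub>R Y))
        (at t within {0..1})"
      unfolding E_def
      by (intro has_vector_derivative_mult exp_scaleR_has_vector_derivative_left
          exp_scaleR_has_vector_derivative_right has_vector_derivative_at_within)
    then show ?thesis
      by (simp add: E_def mult.assoc add.commute)
  qed
  define f where "f t = W t - E t" for t
  define f' where "f' t = rep (u t) * W t - (X * E t + E t * Y)" for t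
  have f: "(f has_vector_derivative f' t) (at t within {0..1})" for t
    unfolding f_def f'_def by (intro has_vector_derivative_diff W' E')

  have emb_u: "emb (u t) = op_apply (\<phi> t) (emb (z t))" for t
    unfolding u_def \<phi>_def emb.sum emb.scaleR op_apply.sum_left op_apply.scaleR_left rep_power_emb ..
  have emb_w: "emb (w t) = op_apply (W t) (emb y)" for t
    unfolding w_def W_def exp_nilpotent[OF rep_nilpotent order_refl] emb.sum emb.scaleR
      op_apply.sum_left op_apply.scaleR_left rep_power_emb ..
  have emb_z: "emb (z t) = op_apply (log_quotient (E t)) (emb x + op_apply (E t) (emb y))" for t
    unfolding z_def E_def X_def Y_def by (rule emb_bch_velocity)
  have \<phi>q: "\<phi> t * log_quotient (W t) = 1" for t
    unfolding \<phi>_def W_def log_quotient_def by (rule exp_quotient_times_log_quotient(1)[OF rep_nilpotent])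
  define e where "e t = u t - x - w t" for t
  have emb_e: "emb (e t) = op_apply (\<phi> t)
      (op_apply (log_quotient (E t) - log_quotient (W t)) (emb x + op_apply (E t) (emb y))
        - op_apply (log_quotient (W t)) (op_apply (f t) (emb y)))" for t
  proof -
    have "emb x + op_apply (W t) (emb y)
        = op_apply (\<phi> t) (op_apply (log_quotient (W t)) (emb x + op_apply (W t) (emb y)))"
      by (simp only: op_apply_simps(1)[symmetric] \<phi>q op_apply_simps(2))
    moreover have "emb (e t) = emb (u t) - (emb x + emb (w t))"
      by (simp add: e_def)
    ultimately show ?thesis
      unfolding emb_u emb_w emb_z
      by (simp only: f_def op_apply.diff_left op_apply.diff_right op_apply.add_right) simp
  qed
  have f'_eq: "f' t = rep (e t) * W t + X * f t + f t * Y" for t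
    unfolding f'_def f_def e_def rep.diff X_def[symmetric]
    by (simp add: algebra_simps WY)

  have contW: "continuous_on {0..1} W" and contE: "continuous_on {0..1} E"
    using W' E' has_vector_derivative_continuous
    by (fastforce simp: continuous_on_eq_continuous_within)+
  have "continuous_on {0..1} (\<lambda>t. rep (Z t))"
    using Z' has_vector_derivative_continuous
    by (fastforce simp: continuous_on_eq_continuous_within)
  then have cont\<phi>: "continuous_on {0..1} \<phi>"
    unfolding \<phi>_def by (intro continuous_intros)
  have contq: "continuous_on {0..1} (\<lambda>t. log_quotient (W t))"
    unfolding log_quotient_def by (intro continuous_intros contW)
  obtain RW where RW: "RW \<ge> 0" "\<And>t. t \<in> {0..1} \<Longrightarrow> norm (W t) \<le> RW"
    using bounded_continuous_on_interval[OF contW] by blast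
  obtain RE where RE: "RE \<ge> 0" "\<And>t. t \<in> {0..1} \<Longrightarrow> norm (E t) \<le> RE"
    using bounded_continuous_on_interval[OF contE] by blast
  obtain R\<phi> where R\<phi>: "R\<phi> \<ge> 0" "\<And>t. t \<in> {0..1} \<Longrightarrow> norm (\<phi> t) \<le> R\<phi>"
    using bounded_continuous_on_interval[OF cont\<phi>] by blast
  obtain Rq where Rq: "Rq \<ge> 0" "\<And>t. t \<in> {0..1} \<Longrightarrow> norm (log_quotient (W t)) \<le> Rq"
    using bounded_continuous_on_interval[OF contq] by blast
  define R where "R = max RW RE"
  define C where "C = (\<Sum>k<Suc d. real k * (R + 1) ^ (k - 1))"
  define Ce where "Ce = R\<phi> * (C * (norm x + RE * norm y) + Rq * norm y)"
  obtain Kr where Kr: "Kr \<ge> 0" "\<And>a. norm (rep a) \<le> norm a * Kr"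
    using rep.nonneg_bounded by blast
  have "R \<ge> 0" using RW(1) by (simp add: R_def)
  then have "C \<ge> 0" unfolding C_def by (intro sum_nonneg) auto
  have e_bound: "norm (e t) \<le> Ce * norm (f t)" if t: "t \<in> {0..1}" for t
  proof -
    have emb_norm: "norm (emb v) = norm v" for v by (simp add: norm_Pair)
    have a: "norm (emb x + op_apply (E t) (emb y)) \<le> norm x + RE * norm y"
    proof -
      have "norm (op_apply (E t) (emb y)) \<le> RE * norm y"
        using norm_op_apply[of "E t" "emb y"] mult_right_mono[OF RE(2)[OF t], of "norm y"]
        by (simp add: norm_Pair)
      then show ?thesis
        using norm_triangle_ineq[of "emb x" "op_apply (E t) (emb y)"] emb_norm[of x] by linarith
    qed
    have b: "norm (log_quotient (E t) - log_quotient (W t)) \<le> C * norm (f t)"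
      using norm_log_quotient_diff_le[of "E t" R "W t"] RW(2)[OF t] RE(2)[OF t]
      by (simp add: R_def C_def f_def norm_minus_commute)
    have c: "norm (op_apply (log_quotient (E t) - log_quotient (W t)) (emb x + op_apply (E t) (emb y)))
        \<le> (C * norm (f t)) * (norm x + RE * norm y)"
      by (rule order_trans[OF norm_op_apply mult_mono[OF b a]]) (use \<open>C \<ge> 0\<close> in auto)
    have g: "norm (op_apply (f t) (emb y)) \<le> norm (f t) * norm y"
      using norm_op_apply[of "f t" "emb y"] by (simp add: norm_Pair)
    have h: "norm (op_apply (log_quotient (W t)) (op_apply (f t) (emb y)))
        \<le> Rq * (norm (f t) * norm y)"
      by (rule order_trans[OF norm_op_apply mult_mono[OF Rq(2)[OF t] g]]) (use Rq(1) in auto)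
    have "norm (emb (e t)) \<le> R\<phi> *
        ((C * norm (f t)) * (norm x + RE * norm y) + Rq * (norm (f t) * norm y))"
      unfolding emb_e
      by (rule order_trans[OF norm_op_apply mult_mono[OF R\<phi>(2)[OF t]
          order_trans[OF norm_triangle_ineq4 add_mono[OF c h]]]]) (use R\<phi>(1) in auto)
    also have "\<dots> = Ce * norm (f t)"
      by (simp add: Ce_def algebra_simps)
    finally show ?thesis by (simp only: emb_norm)
  qed
  have "f 1 = 0"
  proof (rule zero_if_norm_derivative_le[where T = 1 and f = f and f' = f'
        and K = "Ce * Kr * RW + norm X + norm Y"])
    fix t :: real assume "0 \<le> t" "t \<le> 1"
    then have t: "t \<in> {0..1}" by simp
    have "norm (rep (e t)) \<le> Ce * norm (f t) * Kr"
      using Kr(2)[of "e t"] mult_right_mono[OF e_bound[OF t] Kr(1)] by linarith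
    then have "norm (rep (e t) * W t) \<le> (Ce * norm (f t) * Kr) * RW"
      using RW(2)[OF t] RW(1)
      by (intro order_trans[OF norm_mult_ineq] mult_mono) (auto intro: order_trans[OF norm_ge_zero])
    moreover have "norm (X * f t) \<le> norm X * norm (f t)" "norm (f t * Y) \<le> norm (f t) * norm Y"
      by (rule norm_mult_ineq)+
    moreover have "norm (f' t) \<le> norm (rep (e t) * W t) + norm (X * f t) + norm (f t * Y)"
      unfolding f'_eq by (meson add_right_mono norm_triangle_ineq norm_triangle_le order_trans)
    ultimately show "norm (f' t) \<le> (Ce * Kr * RW + norm X + norm Y) * norm (f t)"
      by (simp add: algebra_simps)
  qed (use f in \<open>auto simp: f_def W_def E_def Z_def bch_path_0 rep.zero\<close>)
  then show ?thesis
    by (simp add: f_def W_def E_def Z_def X_def Y_def bch_path_1)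
qed

section \<open>Group laws\<close>

text \<open>
  The logarithm of a unipotent operator inverts the exponential. Besides injectivity, which yields the
  group laws, this gives a bound for \<open>x\<close> in terms of \<open>exp (rep x) - 1\<close>.
\<close>

lemma rep_eq_log: "rep x = log_quotient (exp (rep x)) * (exp (rep x) - 1)"
proof -
  let ?\<phi> = "\<Sum>k<Suc d. (1 / fact (Suc k)) *\<^sub>R rep x ^ k"
  have "exp (rep x) = (\<Sum>k<Suc (Suc d). (1 / fact k) *\<^sub>R rep x ^ k)"
    by (rule exp_nilpotent[OF rep_nilpotent]) simp
  then have "exp (rep x) - 1 = ?\<phi> * rep x"
    by (simp only: sum.lessThan_Suc_shift[of _ "Suc d"])
      (simp add: sum_distrib_right power_commutes del: sum.lessThan_Suc fact_Suc)
  then have "log_quotient (exp (rep x)) * (exp (rep x) - 1) = (log_quotient (exp (rep x)) * ?\<phi>) * rep x"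
    by (simp only: mult.assoc)
  also have "log_quotient (exp (rep x)) * ?\<phi> = 1"
    unfolding log_quotient_def by (rule exp_quotient_times_log_quotient(2)[OF rep_nilpotent])
  finally show ?thesis by simp
qed

lemma exp_rep_inject: "exp (rep x) = exp (rep y) \<longleftrightarrow> x = y"
  by (metis rep_eq_log rep_inject)

lemma gmult_assoc: "gmult G (gmult G x y) z = gmult G x (gmult G y z)"
  by (simp add: exp_rep_gmult mult.assoc flip: exp_rep_inject)

lemma gmult_0_left [simp]: "gmult G 0 x = x"
  and gmult_0_right [simp]: "gmult G x 0 = x"
  by (simp_all add: exp_rep_gmult rep.zero flip: exp_rep_inject)

lemma gmult_minus_left [simp]: "gmult G (- x) x = 0"
  and gmult_minus_right [simp]: "gmult G x (- x) = 0"
proof -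
  have "exp (- rep x) * exp (rep x) = 1"
    using exp_minus_inverse[of "- rep x"] by simp
  then show "gmult G (- x) x = 0" "gmult G x (- x) = 0"
    by (simp_all add: exp_rep_gmult rep.zero rep.neg exp_minus_inverse flip: exp_rep_inject)
qed

lemma gmult_cancel [simp]: "gmult G (- x) (gmult G x y) = y" "gmult G x (gmult G (- x) y) = y"
  by (simp_all flip: gmult_assoc)

lemma minus_gmult: "- gmult G x y = gmult G (- y) (- x)"
proof -
  have "gmult G (gmult G (- y) (- x)) (gmult G x y) = 0"
    by (simp add: gmult_assoc)
  then have "gmult G (gmult G (gmult G (- y) (- x)) (gmult G x y)) (- gmult G x y) = - gmult G x y"
    by simp
  then show ?thesis
    by (simp only: gmult_assoc[of _ "gmult G x y"] gmult_minus_right gmult_0_right)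
qed

lemma gmult_commuting:
  assumes "br x y = 0"
  shows "gmult G x y = x + y"
proof -
  have "rep x * rep y = rep y * rep x"
    using rep_bracket[of x y] assms by (simp add: commutator_def rep.zero)
  then show ?thesis
    by (simp add: exp_rep_gmult rep.add exp_add_commuting flip: exp_rep_inject)
qed

lemma gmult_scaleR_same: "gmult G (s *\<^sub>R v) (t *\<^sub>R v) = (s + t) *\<^sub>R v"
  by (simp add: gmult_commuting br.scaleR_left br.scaleR_right scaleR_add_left)

lemma dilation_lie_word: "dilation G r (lie_word G xs) = lie_word G (map (dilation G r) xs)"
  by (induction xs rule: induct_list012) (simp_all add: dilation_bracket linear_0[OF linear_dilation])

lemma dilation_bch_part: "dilation G r (bch_part G m x y) = bch_part G m (dilation G r x) (dilation G r y)"
proof -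
  interpret D: linear "dilation G r" by (rule linear_dilation)
  have "map (dilation G r) (dynkin_word x y ps) = dynkin_word (dilation G r x) (dilation G r y) ps" for ps
    by (induction ps) auto
  then show ?thesis
    by (simp add: bch_part_eq D.sum D.scale dilation_lie_word)
qed

lemma dilation_gmult: "dilation G r (gmult G x y) = gmult G (dilation G r x) (dilation G r y)"
proof -
  interpret D: linear "dilation G r" by (rule linear_dilation)
  show ?thesis
    by (simp add: gmult_def D.add D.sum dilation_bch_part)
qed

lemma component_1_gmult: "comp 1 (gmult G x y) = comp 1 x + comp 1 y"
proof -
  have "1 \<in> ix" using depth_ge_1 by (simp add: mem_ix)
  then interpret c: linear "comp 1" by (rule linear_component)
  have word: "comp 1 (lie_word G xs) = 0" if "length xs \<ge> 2" for xs
    using that component_lie_word_zero[OF \<open>1 \<in> ix\<close>, of xs] by simp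
  have "comp 1 (bch_part G m x y) = 0" if "m \<ge> 2" for m
    unfolding bch_part_eq c.sum c.scale using that
    by (intro sum.neutral ballI)
      (simp add: word[unfolded One_nat_def] length_dynkin_word dynkin_indices_eq)
  then have "(\<Sum>m=2..nilpotency_step G. comp 1 (bch_part G m x y)) = 0"
    by (intro sum.neutral) simp
  then show ?thesis
    unfolding gmult_def c.add c.sum by simp
qed

end

section \<open>Density points of an arbitrary subset of the line\<close>

text \<open>
  Vitali's theorem selects disjoint intervals in \<open>U\<close> that cover almost all of \<open>B\<close> and on which \<open>A\<close> has
  outer density at most \<open>c\<close>. Outer measure is not additive, so each piece of \<open>A\<close> is replaced by a
  measurable hull of the same measure, cut down to its interval.
\<close>

lemma outer_measure_le_if_Vitali_cover:
  fixes A B :: "real set"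
  assumes "open U" "B \<subseteq> U" and c: "0 \<le> c"
    and cover: "\<And>t \<delta>. t \<in> B \<Longrightarrow> 0 < \<delta> \<Longrightarrow>
      \<exists>r. 0 < r \<and> r < \<delta> \<and> outer_measure_of lebesgue (A \<inter> {t - r<..<t + r}) \<le> ennreal (c * (2 * r))"
    and "B \<subseteq> A"
  shows "outer_measure_of lebesgue B \<le> ennreal c * emeasure lebesgue U"
proof -
  define K where "K = {(t, r). 0 < r \<and> ball t r \<subseteq> U \<and>
    outer_measure_of lebesgue (A \<inter> ball t r) \<le> ennreal c * emeasure lebesgue (ball t r)}"
  have cov: "\<exists>i. i \<in> K \<and> t \<in> ball (fst i) (snd i) \<and> snd i < \<delta>" if t: "t \<in> B" and "0 < \<delta>" for t \<delta>
  proof -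
    obtain e where e: "0 < e" "ball t e \<subseteq> U"
      using \<open>open U\<close> \<open>B \<subseteq> U\<close> t by (meson openE subsetD)
    obtain r where r: "0 < r" "r < min \<delta> e"
      and m: "outer_measure_of lebesgue (A \<inter> {t - r<..<t + r}) \<le> ennreal (c * (2 * r))"
      using cover[OF t, of "min \<delta> e"] \<open>0 < \<delta>\<close> e(1) by auto
    have "ball t r \<subseteq> U"
      using r e by (auto simp: subset_iff)
    then have "(t, r) \<in> K"
      using m r(1) c by (simp add: K_def ball_eq_greaterThanLessThan ennreal_mult)
    then show ?thesis
      using r by (intro exI[of _ "(t, r)"]) auto
  qed
  obtain F where F: "countable F" "F \<subseteq> K"
    and disj: "pairwise (\<lambda>i j. disjnt (ball (fst i) (snd i)) (ball (fst j) (snd j))) F"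
    and neg: "negligible (B - (\<Union>i\<in>F. ball (fst i) (snd i)))"
    by (rule Vitali_covering_theorem_balls[of B K fst snd, OF cov]) (assumption | rule that)+
  let ?b = "\<lambda>i. ball (fst i) (snd i) :: real set"
  have "\<forall>i. \<exists>E\<in>sets lebesgue. A \<inter> ?b i \<subseteq> E \<and> outer_measure_of lebesgue (A \<inter> ?b i) = emeasure lebesgue E"
    by (intro allI outer_measure_of_attain) simp
  then obtain E where E: "\<And>i. E i \<in> sets lebesgue" "\<And>i. A \<inter> ?b i \<subseteq> E i"
    "\<And>i. outer_measure_of lebesgue (A \<inter> ?b i) = emeasure lebesgue (E i)"
    by metis
  let ?E = "\<lambda>i. E i \<inter> ?b i"
  let ?N = "B - (\<Union>i\<in>F. ?b i)"
  have sb: "?b i \<in> sets lebesgue" for i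
    by simp
  have sE: "?E i \<in> sets lebesgue" for i
    by (rule sets.Int[OF E(1) sb])
  have N: "?N \<in> null_sets lebesgue"
    using neg by (simp add: negligible_iff_null_sets)
  have disj_b: "disjoint_family_on ?b F"
    using disj by (auto simp: disjoint_family_on_def pairwise_def disjnt_def)
  then have disj_E: "disjoint_family_on ?E F"
    by (fastforce simp: disjoint_family_on_def)
  have sU: "(\<Union>i\<in>F. ?E i) \<in> sets lebesgue"
    by (rule sets.countable_UN'[OF F(1)]) (use sE in blast)
  have "outer_measure_of lebesgue B \<le> emeasure lebesgue (?N \<union> (\<Union>i\<in>F. ?E i))"
  proof -
    have "B \<subseteq> ?N \<union> (\<Union>i\<in>F. ?E i)"
      using E(2) \<open>B \<subseteq> A\<close> by blast
    moreover have "?N \<union> (\<Union>i\<in>F. ?E i) \<in> sets lebesgue"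
      using N sU by blast
    ultimately show ?thesis
      using outer_measure_of_mono[of B "?N \<union> (\<Union>i\<in>F. ?E i)" lebesgue]
      by (simp only: outer_measure_of_eq)
  qed
  also have "\<dots> = emeasure lebesgue (\<Union>i\<in>F. ?E i)"
    unfolding Un_commute[of ?N]
    by (rule emeasure_Un_null_set[OF sU N])
  also have "\<dots> = (\<integral>\<^sup>+i. emeasure lebesgue (?E i) \<partial>count_space F)"
    by (rule emeasure_UN_countable[OF sE F(1) disj_E])
  also have "\<dots> \<le> (\<integral>\<^sup>+i. ennreal c * emeasure lebesgue (?b i) \<partial>count_space F)"
  proof (rule nn_integral_mono)
    fix i assume "i \<in> space (count_space F)"
    then have "outer_measure_of lebesgue (A \<inter> ?b i) \<le> ennreal c * emeasure lebesgue (?b i)"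
      using F(2) by (auto simp: K_def)
    then show "emeasure lebesgue (?E i) \<le> ennreal c * emeasure lebesgue (?b i)"
      using emeasure_mono[of "?E i" "E i" lebesgue] E(1,3) by auto
  qed
  also have "\<dots> = ennreal c * (\<integral>\<^sup>+i. emeasure lebesgue (?b i) \<partial>count_space F)"
    by (rule nn_integral_cmult) simp
  also have "(\<integral>\<^sup>+i. emeasure lebesgue (?b i) \<partial>count_space F) = emeasure lebesgue (\<Union>i\<in>F. ?b i)"
    by (rule emeasure_UN_countable[OF sb F(1) disj_b, symmetric])
  also have "\<dots> \<le> emeasure lebesgue U"
  proof (rule emeasure_mono)
    have "?b i \<subseteq> U" if "i \<in> F" for i
    proof -
      have "i \<in> K" using F(2) that by blast
      then show ?thesis unfolding K_def by (cases i) simp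
    qed
    then show "(\<Union>i\<in>F. ?b i) \<subseteq> U" by blast
  qed (use \<open>open U\<close> in auto)
  finally show ?thesis by (simp add: mult_left_mono)
qed

text \<open>
  By the previous lemma, a bounded piece of outer measure \<open>x\<close> inside an open set of measure at most \<open>x + e\<close>
  satisfies \<open>x \<le> c (x + e)\<close>; as \<open>e\<close> is arbitrary and \<open>c < 1\<close>, it is null.
\<close>

lemma negligible_low_density:
  fixes A :: "real set"
  assumes c: "0 \<le> c" "c < 1"
  shows "negligible {t \<in> A. \<forall>\<delta>>0. \<exists>r. 0 < r \<and> r < \<delta> \<and>
    outer_measure_of lebesgue (A \<inter> {t - r<..<t + r}) \<le> ennreal (c * (2 * r))}"
    (is "negligible ?B")
proof (rule negligible_on_intervals[THEN iffD2], intro allI)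
  fix a b :: real
  let ?S = "?B \<inter> cbox a b"
  define m where "m = outer_measure_of lebesgue ?S"
  have "m \<le> outer_measure_of lebesgue (cbox a b)"
    unfolding m_def by (rule outer_measure_of_mono) auto
  also have "\<dots> = emeasure lebesgue (cbox a b)"
    by (rule outer_measure_of_eq) simp
  also have "\<dots> < \<infinity>"
    using lmeasurable_cbox[of a b] by (auto simp only: fmeasurable_def)
  finally have "m < \<infinity>" .
  then obtain x where x: "0 \<le> x" "m = ennreal x"
    by (cases m) auto
  obtain E where E: "E \<in> sets lebesgue" "?S \<subseteq> E" "m = emeasure lebesgue E"
    using outer_measure_of_attain[of ?S lebesgue] unfolding m_def by auto
  have "x \<le> c * (x + e)" if "0 < e" for e
  proof -
    obtain U where U: "open U" "E \<subseteq> U" "U - E \<in> lmeasurable" "emeasure lebesgue (U - E) < ennreal e"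
      using sets_lebesgue_outer_open[OF E(1) \<open>0 < e\<close>] by metis
    have "m \<le> ennreal c * emeasure lebesgue U"
      unfolding m_def
      by (rule outer_measure_le_if_Vitali_cover[where A = A]) (use U E(2) c in auto)
    also have "emeasure lebesgue U \<le> ennreal x + ennreal e"
    proof -
      have "emeasure lebesgue U \<le> emeasure lebesgue E + emeasure lebesgue (U - E)"
        using emeasure_subadditive[of E lebesgue "U - E"] E(1) U
        by (auto simp: Un_absorb1 fmeasurableD)
      also have "\<dots> \<le> ennreal x + ennreal e"
        using U(4) E(3) x(2) by (intro add_mono) auto
      finally show ?thesis .
    qed
    finally have "ennreal x \<le> ennreal (c * (x + e))"
      using x c \<open>0 < e\<close> by (simp add: ennreal_mult mult_left_mono)
    then show ?thesis
      using x c \<open>0 < e\<close> by (simp add: ennreal_le_iff)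
  qed
  then have "x \<le> c * x"
  proof -
    assume *: "\<And>e. 0 < e \<Longrightarrow> x \<le> c * (x + e)"
    show ?thesis
    proof (rule field_le_epsilon)
      fix e :: real assume "0 < e"
      have "c * e \<le> 1 * e" using c \<open>0 < e\<close> by (intro mult_right_mono) auto
      then show "x \<le> c * x + e" using *[OF \<open>0 < e\<close>] by (simp add: algebra_simps)
    qed
  qed
  then have "x = 0"
    using x c by (metis antisym_conv leD mult_less_cancel_right2 not_less_iff_gr_or_eq)
  then have "E \<in> null_sets lebesgue"
    using E x by auto
  then show "negligible ?S"
    using E(2) negligible_iff_null_sets negligible_subset by blast
qed

lemma AE_density_point:
  fixes A :: "real set"
  shows "AE t in lebesgue. t \<in> A \<longrightarrow> density_point A t"
proof -
  define B where "B k = {t \<in> A. \<forall>\<delta>>0. \<exists>r. 0 < r \<and> r < \<delta> \<and>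
    outer_measure_of lebesgue (A \<inter> {t - r<..<t + r}) \<le> ennreal ((1 - 1 / real (Suc k)) * (2 * r))}" for k
  have "AE t in lebesgue. t \<notin> B k" for k
    unfolding B_def
    by (rule AE_not_in, subst negligible_iff_null_sets[symmetric], rule negligible_low_density) auto
  then have "AE t in lebesgue. \<forall>k. t \<notin> B k"
    by (simp add: AE_all_countable)
  then show ?thesis
  proof (rule AE_mp, intro AE_I2 impI)
    fix t assume nB: "\<forall>k. t \<notin> B k" and "t \<in> A"
    let ?m = "\<lambda>r. outer_measure_of lebesgue (A \<inter> {t - r<..<t + r})"
    have le: "?m r \<le> ennreal (2 * r)" if "0 < r" for r
    proof -
      have "?m r \<le> outer_measure_of lebesgue {t - r<..<t + r}"
        by (rule outer_measure_of_mono) auto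
      then show ?thesis using that by simp
    qed
    show "density_point A t"
      unfolding density_point_def
    proof (rule tendstoI)
      fix e :: real assume "0 < e"
      then obtain k where k: "1 / real (Suc k) < e"
        using nat_approx_posE by blast
      obtain \<delta> where \<delta>: "0 < \<delta>"
        and m: "\<And>r. 0 < r \<Longrightarrow> r < \<delta> \<Longrightarrow> \<not> ?m r \<le> ennreal ((1 - 1 / real (Suc k)) * (2 * r))"
        using nB \<open>t \<in> A\<close> unfolding B_def by blast
      show "\<forall>\<^sub>F r in at_right 0. dist (enn2real (?m r) / (2 * r)) 1 < e"
        unfolding eventually_at_right_field
      proof (intro exI[of _ \<delta>] conjI allI impI \<delta>)
        fix r :: real assume r: "0 < r" "r < \<delta>"
        obtain y where y: "0 \<le> y" "?m r = ennreal y"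
          using le[OF r(1)] by (cases "?m r") (auto simp: top_unique)
        have "y \<le> 2 * r"
          using le[OF r(1)] y r by (simp add: ennreal_le_iff)
        moreover have "(1 - 1 / real (Suc k)) * (2 * r) < y"
          using m[OF r] y r by (auto simp: ennreal_le_iff not_le intro: ccontr)
        ultimately have "1 - 1 / real (Suc k) < y / (2 * r)" "y / (2 * r) \<le> 1"
          using r(1) by (simp_all add: field_simps)
        then show "dist (enn2real (?m r) / (2 * r)) 1 < e"
          using k y by (simp add: dist_real_def)
      qed
    qed
  qed
qed

text \<open>
  An interval of length \<open>\<epsilon> r\<close> in \<open>(t - r, t + r)\<close> that misses \<open>A\<close> brings the density ratio down to
  at most \<open>1 - \<epsilon>/2\<close>. In this form density enters the proof of differentiability.
\<close>

lemma density_point_meets: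
  assumes "density_point A t" "0 < \<epsilon>"
  shows "\<exists>\<delta>>0. \<forall>r a b. 0 < r \<and> r < \<delta> \<and> t - r \<le> a \<and> b \<le> t + r \<and> \<epsilon> * r \<le> b - a
    \<longrightarrow> A \<inter> {a<..<b} \<noteq> {}"
proof -
  let ?m = "\<lambda>r. enn2real (outer_measure_of lebesgue (A \<inter> {t - r<..<t + r}))"
  have "\<forall>\<^sub>F r in at_right 0. dist (?m r / (2 * r)) 1 < \<epsilon> / 2"
    using assms unfolding density_point_def by (intro tendstoD) auto
  then obtain \<delta> where \<delta>: "0 < \<delta>" "\<And>r. 0 < r \<Longrightarrow> r < \<delta> \<Longrightarrow> dist (?m r / (2 * r)) 1 < \<epsilon> / 2"
    unfolding eventually_at_right_field by auto
  have "A \<inter> {a<..<b} \<noteq> {}"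
    if r: "0 < r" "r < \<delta>" and ab: "t - r \<le> a" "b \<le> t + r" "\<epsilon> * r \<le> b - a" for r a b
  proof
    assume "A \<inter> {a<..<b} = {}"
    then have "outer_measure_of lebesgue (A \<inter> {t - r<..<t + r})
        \<le> outer_measure_of lebesgue ({t - r<..a} \<union> {b..<t + r})"
      by (intro outer_measure_of_mono) force
    also have "\<dots> \<le> emeasure lebesgue {t - r<..a} + emeasure lebesgue {b..<t + r}"
      by (simp add: emeasure_subadditive)
    also have "\<dots> = ennreal (2 * r - (b - a))"
      using ab r mult_pos_pos[OF \<open>0 < \<epsilon>\<close> r(1)] by (simp flip: ennreal_plus)
    finally have "?m r \<le> 2 * r - (b - a)"
      using ab r mult_pos_pos[OF \<open>0 < \<epsilon>\<close> r(1)] by (auto intro!: enn2real_leI)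
    then have "?m r / (2 * r) \<le> (2 * r - \<epsilon> * r) / (2 * r)"
      using r ab by (intro divide_right_mono) auto
    also have "\<dots> = 1 - \<epsilon> / 2"
      using r by (simp add: field_simps)
    finally show False
      using \<delta>(2)[OF r] unfolding dist_real_def by linarith
  qed
  then show ?thesis using \<delta>(1) by blast
qed

section \<open>Lipschitz extension from a subset of the line\<close>

text \<open>
  Linear interpolation in the bounded gaps of \<open>S\<close>, constant continuation beyond its ends. In contrast to
  general Lipschitz extension results, this keeps the values in the subspace and works in any normed
  space.
\<close>

lemma lipschitz_extension_closed_real:
  fixes f :: "real \<Rightarrow> 'a::real_normed_vector"
  assumes f: "C-lipschitz_on S f" and "closed S" "S \<noteq> {}" and fX: "f ` S \<subseteq> X" and X: "subspace X"
  shows "\<exists>g. C-lipschitz_on UNIV g \<and> (\<forall>t\<in>S. g t = f t) \<and> range g \<subseteq> X"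
proof -
  have "C \<ge> 0" using f by (rule lipschitz_on_nonneg)
  have fS: "norm (f s - f t) \<le> C * \<bar>s - t\<bar>" if "s \<in> S" "t \<in> S" for s t
    using lipschitz_onD[OF f that] by (simp add: dist_norm)
  define l where "l t = Sup (S \<inter> {..t})" for t
  define h where "h t = Inf (S \<inter> {t..})" for t
  define g where "g t = (if t \<in> S then f t else if S \<inter> {..t} = {} then f (h t)
      else if S \<inter> {t..} = {} then f (l t)
      else f (l t) + ((t - l t) / (h t - l t)) *\<^sub>R (f (h t) - f (l t)))" for t
  have l: "l t \<in> S" "l t \<le> t" "\<And>s. s \<in> S \<Longrightarrow> s \<le> t \<Longrightarrow> s \<le> l t" if "S \<inter> {..t} \<noteq> {}" for t
  proof -
    have bdd: "bdd_above (S \<inter> {..t})" by (rule bdd_aboveI[of _ t]) auto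
    have "l t \<in> S \<inter> {..t}"
      unfolding l_def using that bdd \<open>closed S\<close> by (intro closed_contains_Sup closed_Int) auto
    then show "l t \<in> S" "l t \<le> t" by auto
    show "s \<le> l t" if "s \<in> S" "s \<le> t" for s
      unfolding l_def using that bdd by (intro cSup_upper) auto
  qed
  have h: "h t \<in> S" "t \<le> h t" "\<And>s. s \<in> S \<Longrightarrow> t \<le> s \<Longrightarrow> h t \<le> s" if "S \<inter> {t..} \<noteq> {}" for t
  proof -
    have bdd: "bdd_below (S \<inter> {t..})" by (rule bdd_belowI[of _ t]) auto
    have "h t \<in> S \<inter> {t..}"
      unfolding h_def using that bdd \<open>closed S\<close> by (intro closed_contains_Inf closed_Int) auto
    then show "h t \<in> S" "t \<le> h t" by auto
    show "h t \<le> s" if "s \<in> S" "t \<le> s" for s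
      unfolding h_def using that bdd by (intro cInf_lower) auto
  qed
  have slope: "norm ((a / (h t - l t)) *\<^sub>R (f (h t) - f (l t))) \<le> C * \<bar>a\<bar>"
    if "S \<inter> {..t} \<noteq> {}" "S \<inter> {t..} \<noteq> {}" "t \<notin> S" for a t
  proof -
    have "l t < t" "t < h t" using l[OF that(1)] h[OF that(2)] that(3) by (metis order.order_iff_strict)+
    then have pos: "0 < h t - l t" by simp
    have "norm ((a / (h t - l t)) *\<^sub>R (f (h t) - f (l t))) \<le> (\<bar>a\<bar> / (h t - l t)) * (C * \<bar>h t - l t\<bar>)"
      unfolding norm_scaleR using pos
      by (intro mult_mono fS[OF h(1)[OF that(2)] l(1)[OF that(1)]]) auto
    also have "\<dots> = C * \<bar>a\<bar>" using pos by simp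
    finally show ?thesis .
  qed
  have gS: "g t = f t" if "t \<in> S" for t using that by (simp add: g_def)
  have right: "norm (g t - g s) \<le> C * (s - t)" if s: "s \<in> S" and ts: "t \<le> s" for s t
  proof (cases "t \<in> S")
    case True
    then show ?thesis using fS[OF True s] ts by (simp add: gS s)
  next
    case False
    have ne: "S \<inter> {t..} \<noteq> {}" using s ts by auto
    have hs: "norm (f (h t) - f s) \<le> C * (s - h t)"
      using fS[OF h(1)[OF ne] s] h(3)[OF ne s ts] by simp
    have "norm (g t - f (h t)) \<le> C * (h t - t)"
    proof (cases "S \<inter> {..t} = {}")
      case True
      then show ?thesis using False h(2)[OF ne] \<open>C \<ge> 0\<close> by (simp add: g_def)
    next
      case nl: False
      have "l t < t" "t < h t" using l[OF nl] h[OF ne] False by (metis order.order_iff_strict)+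
      then have "(t - l t) / (h t - l t) - 1 = (t - h t) / (h t - l t)"
        by (simp add: field_simps)
      moreover have "g t - f (h t) = ((t - l t) / (h t - l t) - 1) *\<^sub>R (f (h t) - f (l t))"
        using False nl ne by (simp add: g_def scaleR_diff_left)
      ultimately show ?thesis
        using slope[OF nl ne False, of "t - h t"] \<open>t < h t\<close> by simp
    qed
    then have "norm ((g t - f (h t)) + (f (h t) - f s)) \<le> C * (h t - t) + C * (s - h t)"
      by (intro norm_triangle_le add_mono hs)
    then show ?thesis by (simp add: gS s algebra_simps)
  qed
  have left: "norm (g t - g s) \<le> C * (t - s)" if s: "s \<in> S" and ts: "s \<le> t" for s t
  proof (cases "t \<in> S")
    case True
    then show ?thesis using fS[OF True s] ts by (simp add: gS s)
  next
    case False
    have ne: "S \<inter> {..t} \<noteq> {}" using s ts by auto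
    have ls: "norm (f (l t) - f s) \<le> C * (l t - s)"
      using fS[OF l(1)[OF ne] s] l(3)[OF ne s ts] by simp
    have "norm (g t - f (l t)) \<le> C * (t - l t)"
    proof (cases "S \<inter> {t..} = {}")
      case True
      then show ?thesis using False ne l(2)[OF ne] \<open>C \<ge> 0\<close> by (simp add: g_def)
    next
      case nh: False
      then show ?thesis
        using slope[OF ne nh False, of "t - l t"] l(2)[OF ne] False ne by (simp add: g_def)
    qed
    then have "norm ((g t - f (l t)) + (f (l t) - f s)) \<le> C * (t - l t) + C * (l t - s)"
      by (intro norm_triangle_le add_mono ls)
    then show ?thesis by (simp add: gS s algebra_simps)
  qed
  have lip: "norm (g t - g u) \<le> C * (u - t)" if "t \<le> u" for t u
  proof (cases "S \<inter> {t..u} = {}")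
    case False
    then obtain s where "s \<in> S" "t \<le> s" "s \<le> u" by auto
    then have "norm ((g t - g s) - (g u - g s)) \<le> C * (s - t) + C * (u - s)"
      by (intro norm_triangle_le_diff add_mono right left)
    then show ?thesis by (simp add: algebra_simps)
  next
    case True
    then have eq: "S \<inter> {..u} = S \<inter> {..t}" "S \<inter> {u..} = S \<inter> {t..}" and notin: "t \<notin> S" "u \<notin> S"
      using \<open>t \<le> u\<close> by force+
    have lh: "l u = l t" "h u = h t" unfolding l_def h_def eq by simp_all
    show ?thesis
    proof (cases "S \<inter> {..t} = {} \<or> S \<inter> {t..} = {}")
      case True
      then have "g t = g u"
        using notin by (auto simp: g_def lh eq)
      then show ?thesis using \<open>C \<ge> 0\<close> \<open>t \<le> u\<close> by simp
    next
      case False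
      then have "g t - g u = ((t - u) / (h t - l t)) *\<^sub>R (f (h t) - f (l t))"
        using notin by (simp add: g_def lh eq diff_divide_distrib algebra_simps)
      then show ?thesis
        using slope[of t "t - u"] False notin \<open>t \<le> u\<close> by simp
    qed
  qed
  have "C-lipschitz_on UNIV g"
  proof (rule lipschitz_onI)
    fix t u :: real
    show "dist (g t) (g u) \<le> C * dist t u"
      using lip[of t u] lip[of u t]
      by (cases "t \<le> u") (auto simp: dist_norm norm_minus_commute)
  qed (rule \<open>C \<ge> 0\<close>)
  moreover have "g t \<in> X" for t
  proof -
    have fx: "f s \<in> X" if "s \<in> S" for s using fX that by auto
    show ?thesis
      unfolding g_def using l(1) h(1) \<open>S \<noteq> {}\<close>
      by (auto intro!: fx subspace_add[OF X] subspace_scale[OF X] subspace_diff[OF X])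
        (metis disjoint_iff atLeast_iff atMost_iff linear)
  qed
  ultimately show ?thesis using gS by (intro exI[of _ g]) auto
qed

lemma lipschitz_extension_real:
  fixes f :: "real \<Rightarrow> 'a::banach"
  assumes f: "C-lipschitz_on A f" and fX: "f ` A \<subseteq> X" and X: "subspace X" "closed X"
  shows "\<exists>g. C-lipschitz_on UNIV g \<and> (\<forall>t\<in>A. g t = f t) \<and> range g \<subseteq> X"
proof (cases "A = {}")
  case True
  have "C \<ge> 0" using f by (rule lipschitz_on_nonneg)
  then have "C-lipschitz_on UNIV (\<lambda>t::real. 0 :: 'a)" by (intro lipschitz_onI) auto
  then show ?thesis using True subspace_0[OF X(1)] by (intro exI[of _ "\<lambda>t. 0"]) auto
next
  case False
  obtain f' where f': "C-lipschitz_on (closure A) f'" "\<And>t. t \<in> A \<Longrightarrow> f' t = f t"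
    using lipschitz_extend_closure[OF f] by blast
  have "f' ` closure A \<subseteq> X"
    using f'(2) fX lipschitz_on_continuous_on[OF f'(1)] X(2)
    by (intro image_closure_subset) auto
  then obtain g where "C-lipschitz_on UNIV g" "\<forall>t\<in>closure A. g t = f' t" "range g \<subseteq> X"
    using lipschitz_extension_closed_real[OF f'(1) closed_closure _ _ X(1)] False by auto
  then show ?thesis
    using f'(2) closure_subset by (metis subsetD)
qed

section \<open>The homogeneous norm\<close>

locale homogeneous_group =
  fixes G :: "'m::banach graded_structure"
  assumes homogeneous: "banach_homogeneous_group G"

sublocale homogeneous_group \<subseteq> graded_algebra
  using homogeneous by unfold_locales (simp add: banach_homogeneous_group_def)

context homogeneous_group
begin

abbreviation hn :: "'m \<Rightarrow> real" where "hn \<equiv> hnorm G"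

lemma scale_1: "scale G 1 = 1"
  and scale_pos: "i \<in> ix \<Longrightarrow> 0 < scale G i"
  and hnorm_triangle: "hn (gmult G x y) \<le> hn x + hn y"
  using homogeneous unfolding banach_homogeneous_group_def ix_def by blast+

lemma one_in_ix: "1 \<in> ix"
  using depth_ge_1 by (simp add: mem_ix)

lemma hnorm_eq: "hn x = Max ((\<lambda>i. scale G i * root i (norm (comp i x))) ` ix)"
  by (simp add: hnorm_def ix_def)

lemma ix_nonempty: "ix \<noteq> {}"
  using one_in_ix by blast

lemma hnorm_ge: "i \<in> ix \<Longrightarrow> scale G i * root i (norm (comp i x)) \<le> hn x"
  unfolding hnorm_eq by (rule Max_ge) auto

lemma hnorm_less_iff: "hn x < e \<longleftrightarrow> (\<forall>i\<in>ix. scale G i * root i (norm (comp i x)) < e)"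
  unfolding hnorm_eq using ix_nonempty by (subst Max_less_iff) auto

lemma norm_component_1_le: "norm (comp 1 x) \<le> hn x"
  using hnorm_ge[OF one_in_ix, of x] scale_1 by simp

lemma hnorm_nonneg: "0 \<le> hn x"
  using norm_component_1_le[of x] norm_ge_zero order_trans by blast

lemma norm_component_le:
  assumes "i \<in> ix"
  shows "norm (comp i x) \<le> (hn x / scale G i) ^ i"
proof -
  have i: "0 < i" using assms by (simp add: mem_ix)
  have "root i (norm (comp i x)) \<le> hn x / scale G i"
    using hnorm_ge[OF assms, of x] scale_pos[OF assms] by (simp add: field_simps)
  then have "root i (norm (comp i x)) ^ i \<le> (hn x / scale G i) ^ i"
    by (intro power_mono) (simp_all add: i)
  then show ?thesis using i by simp
qed

lemma hnorm_minus: "hn (- x) = hn x"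
  unfolding hnorm_eq by (rule arg_cong[where f = Max], intro image_cong refl)
    (simp add: linear_neg[OF linear_component])

lemma hnorm_dilation:
  assumes "0 < r"
  shows "hn (dilation G r x) = r * hn x"
proof -
  have eq: "scale G i * root i (norm (comp i (dilation G r x))) = r * (scale G i * root i (norm (comp i x)))"
    if "i \<in> ix" for i
    using that assms
    by (simp add: component_dilation real_root_mult real_root_pos2 mem_ix power_abs)
  have "hn (dilation G r x) = Max ((\<lambda>y. r * y) ` (\<lambda>i. scale G i * root i (norm (comp i x))) ` ix)"
    unfolding hnorm_eq image_image by (rule arg_cong[where f = Max], intro image_cong refl eq)
  also have "\<dots> = r * hn x"
    unfolding hnorm_eq using ix_nonempty assms
    by (intro mono_Max_commute[symmetric]) (auto simp: mono_def)
  finally show ?thesis .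
qed

lemma component_layer_1: "i \<in> ix \<Longrightarrow> v \<in> layer G 1 \<Longrightarrow> comp i v = (if i = 1 then v else 0)"
  by (rule component_layer[OF one_in_ix])

lemma dilation_layer_1: "v \<in> layer G 1 \<Longrightarrow> dilation G r v = r *\<^sub>R v"
  using layer_multiplier_layer[OF one_in_ix, of v] by (simp add: dilation_eq_layer_multiplier)

lemma hnorm_layer_1:
  assumes v: "v \<in> layer G 1"
  shows "hn v = norm v"
proof (rule antisym)
  show "hn v \<le> norm v"
    unfolding hnorm_eq using ix_nonempty
    by (subst Max_le_iff) (auto simp: component_layer_1[OF _ v] scale_1[unfolded One_nat_def])
  show "norm v \<le> hn v"
    using norm_component_1_le[of v] component_layer_1[OF one_in_ix v] by simp
qed

lemma scaleR_layer_1: "v \<in> layer G 1 \<Longrightarrow> r *\<^sub>R v \<in> layer G 1"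
  by (rule subspace_scale[OF subspace_layer[OF one_in_ix]])

lemma hnorm_small:
  assumes "0 < e"
  shows "\<exists>\<delta>>0. \<forall>x. norm x < \<delta> \<longrightarrow> hn x < e"
proof -
  have "\<forall>\<^sub>F x in nhds 0. scale G i * root i (norm (comp i x)) < e" if i: "i \<in> ix" for i
  proof -
    have "isCont (\<lambda>x. scale G i * root i (norm (comp i x))) 0"
      using bounded_linear_component[OF i]
      by (intro continuous_intros) (simp add: linear_continuous_at)
    moreover have zero: "scale G i * root i (norm (comp i 0)) < e"
      using assms by (simp add: linear_0[OF linear_component[OF i]])
    ultimately have "\<forall>\<^sub>F x in at 0. scale G i * root i (norm (comp i x)) < e"
      unfolding isCont_def by (rule order_tendstoD(2))
    then show ?thesis
      using zero by (simp add: eventually_nhds_conv_at)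
  qed
  then have "\<forall>\<^sub>F x in nhds 0. hn x < e"
    unfolding hnorm_less_iff by (intro eventually_ball_finite) auto
  then show ?thesis
    by (auto simp: eventually_nhds_metric)
qed

text \<open>
  Multiples of one vector commute, so the group product adds them.
\<close>

lemma h_homomorphism_line:
  assumes v: "v \<in> layer G 1"
  shows "h_homomorphism G (\<lambda>h. h *\<^sub>R v)"
  unfolding h_homomorphism_def
  by (auto simp: gmult_scaleR_same dilation_layer_1[OF scaleR_layer_1[OF v]] intro!: continuous_intros)

section \<open>Products of many small increments\<close>

text \<open>
  A component in a layer \<open>i \<ge> 2\<close> is bounded by the \<open>i\<close>-th power of the homogeneous norm, hence is already
  of second order; only the horizontal component has to be controlled separately.
\<close>

lemma norm_nearly_horizontal:
  assumes "0 \<le> b"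
  shows "\<exists>M\<ge>0. \<forall>N x. 0 < N \<longrightarrow> hn x \<le> b / real N \<longrightarrow> norm (comp 1 x) \<le> 1 / real N ^ 2
    \<longrightarrow> norm x \<le> M / real N ^ 2"
proof (intro exI conjI allI impI)
  \<comment> \<open>the summand 1 accounts for the horizontal component\<close>
  let ?M = "\<Sum>i\<in>ix. 1 + (b / scale G i) ^ i"
  have pos: "0 \<le> (b / scale G i) ^ i" if "i \<in> ix" for i
    using assms scale_pos[OF that] by simp
  then show "0 \<le> ?M" by (intro sum_nonneg) auto
  fix N :: nat and x
  assume N: "0 < N" and x: "hn x \<le> b / real N" "norm (comp 1 x) \<le> 1 / real N ^ 2"
  have "norm (comp i x) \<le> (1 + (b / scale G i) ^ i) / real N ^ 2" if i: "i \<in> ix" for i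
  proof (cases "i = 1")
    case True
    have "1 / real N ^ 2 \<le> (1 + (b / scale G i) ^ i) / real N ^ 2"
      using pos[OF i] by (intro divide_right_mono) auto
    then show ?thesis using x(2) True by simp
  next
    case False
    then have "2 \<le> i" using i by (auto simp: mem_ix)
    have "norm (comp i x) \<le> (hn x / scale G i) ^ i"
      by (rule norm_component_le[OF i])
    also have "\<dots> \<le> (b / real N / scale G i) ^ i"
      using x(1) scale_pos[OF i] hnorm_nonneg[of x] by (intro power_mono divide_right_mono) auto
    also have "\<dots> = (b / scale G i) ^ i / real N ^ i"
      by (simp add: power_divide power_mult_distrib mult.commute)
    also have "\<dots> \<le> (b / scale G i) ^ i / real N ^ 2"
      using pos[OF i] N \<open>2 \<le> i\<close> by (intro divide_left_mono power_increasing) auto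
    also have "\<dots> \<le> (1 + (b / scale G i) ^ i) / real N ^ 2"
      by (intro divide_right_mono) auto
    finally show ?thesis .
  qed
  then have "(\<Sum>i\<in>ix. norm (comp i x)) \<le> (\<Sum>i\<in>ix. (1 + (b / scale G i) ^ i) / real N ^ 2)"
    by (rule sum_mono)
  moreover have "norm x \<le> (\<Sum>i\<in>ix. norm (comp i x))"
    using norm_sum[of "\<lambda>i. comp i x" ix] by (simp add: sum_component)
  ultimately show "norm x \<le> ?M / real N ^ 2"
    by (simp add: sum_divide_distrib)
qed

lemma norm_le_of_exp_rep:
  "\<exists>K>0. \<forall>x. norm (exp (rep x) - 1) \<le> 1 \<longrightarrow> norm x \<le> K * norm (exp (rep x) - 1)"
proof -
  obtain K where K: "K > 0" "\<And>x. norm x \<le> K * norm (rep x)"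
    using norm_le_norm_rep by blast
  have "norm x \<le> K * real (Suc d) * norm (exp (rep x) - 1)" if le: "norm (exp (rep x) - 1) \<le> 1" for x
  proof -
    have "norm (log_quotient (exp (rep x))) \<le> (\<Sum>k<Suc d. 1)"
      unfolding log_quotient_def
    proof (rule sum_norm_le)
      fix k
      have "norm ((exp (rep x) - 1) ^ k) \<le> 1"
        using norm_power_ineq[of "exp (rep x) - 1" k] power_le_one[OF norm_ge_zero le, of k] by linarith
      moreover have "\<bar>(- 1) ^ k / real (Suc k)\<bar> \<le> 1"
        by (simp add: power_abs)
      ultimately show "norm (((- 1) ^ k / real (Suc k)) *\<^sub>R (exp (rep x) - 1) ^ k) \<le> 1"
        unfolding norm_scaleR by (intro mult_le_one) auto
    qed
    then have "norm (log_quotient (exp (rep x))) \<le> real (Suc d)" by simp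
    then have "norm (rep x) \<le> real (Suc d) * norm (exp (rep x) - 1)"
      by (subst rep_eq_log) (intro order_trans[OF norm_mult_ineq] mult_right_mono, auto)
    then have "K * norm (rep x) \<le> K * (real (Suc d) * norm (exp (rep x) - 1))"
      using K(1) by (intro mult_left_mono) auto
    then show ?thesis using K(2)[of x] by (simp add: mult.assoc)
  qed
  then show ?thesis using K(1) by (intro exI[of _ "K * real (Suc d)"]) auto
qed

text \<open>
  Put \<open>d\<^sub>n = (s\<^sub>n w)\<^sup>-\<^sup>1 p\<^sub>n\<close>, and let \<open>e\<^sub>n = (\<Delta> w)\<^sup>-\<^sup>1 p\<^sub>n\<^sup>-\<^sup>1 p\<^sub>n\<^sub>+\<^sub>1\<close> be the error of an increment, with
  \<open>\<Delta> = s\<^sub>n\<^sub>+\<^sub>1 - s\<^sub>n\<close>. Then \<open>d\<^sub>n\<^sub>+\<^sub>1 = (\<Delta> w)\<^sup>-\<^sup>1 d\<^sub>n (\<Delta> w) e\<^sub>n\<close>. Passing to exponentials, a conjugation by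
  \<open>\<Delta> w\<close> enlarges the distance from \<open>1\<close> at most by the factor \<open>exp (2 |\<Delta>| |rep w|)\<close>, and these factors remain
  bounded in a long product.
\<close>

lemma exp_rep_product_estimate:
  fixes p :: "nat \<Rightarrow> 'm" and s :: "nat \<Rightarrow> real" and w :: 'm
  defines "e \<equiv> \<lambda>k. gmult G (- ((s (Suc k) - s k) *\<^sub>R w)) (gmult G (- p k) (p (Suc k)))"
  assumes p0: "p 0 = 0" and s0: "s 0 = 0"
    and step: "\<And>k. k < N \<Longrightarrow> \<bar>s (Suc k) - s k\<bar> \<le> \<tau>"
    and small: "\<And>k. k < N \<Longrightarrow> norm (rep (e k)) \<le> \<kappa>"
    and "0 \<le> \<tau>" "0 \<le> \<kappa>" "n \<le> N"
  shows "norm (exp (rep (gmult G (- (s n *\<^sub>R w)) (p n))) - 1)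
    \<le> exp (2 * \<tau> * norm (rep w) + \<kappa>) ^ n * (real n * (\<kappa> * exp \<kappa>))"
  using \<open>n \<le> N\<close>
proof (induction n)
  case 0
  then show ?case by (simp add: p0 s0 rep.zero)
next
  case (Suc n)
  define \<Delta> where "\<Delta> = s (Suc n) - s n"
  define q where "q = exp (2 * \<tau> * norm (rep w) + \<kappa>)"
  define D where "D k = exp (rep (gmult G (- (s k *\<^sub>R w)) (p k)))" for k
  define a where "a = exp (rep (- (\<Delta> *\<^sub>R w)))"
  define a' where "a' = exp (rep (\<Delta> *\<^sub>R w))"
  define Q where "Q = exp (rep (e n))"
  have aa': "a * a' = 1"
    by (simp add: a_def a'_def rep.zero flip: exp_rep_gmult)
  have "gmult G (- (s (Suc n) *\<^sub>R w)) (p (Suc n))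
      = gmult G (- (\<Delta> *\<^sub>R w)) (gmult G (gmult G (- (s n *\<^sub>R w)) (p n)) (gmult G (\<Delta> *\<^sub>R w) (e n)))"
  proof -
    have "gmult G (- (\<Delta> *\<^sub>R w)) (- (s n *\<^sub>R w)) = - (s (Suc n) *\<^sub>R w)"
      unfolding scaleR_minus_left[symmetric] gmult_scaleR_same by (simp add: \<Delta>_def)
    then show ?thesis
      by (simp add: e_def \<Delta>_def[symmetric] gmult_assoc flip: gmult_assoc[of "- (\<Delta> *\<^sub>R w)" "- (s n *\<^sub>R w)"])
  qed
  then have DS: "D (Suc n) = a * D n * a' * Q"
    by (simp add: D_def a_def a'_def Q_def exp_rep_gmult mult.assoc)
  have "D (Suc n) - 1 = a * (D n - 1) * a' * Q + (Q - 1)"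
    unfolding DS by (simp add: algebra_simps aa')
  then have "norm (D (Suc n) - 1) \<le> norm (a * (D n - 1) * a' * Q) + norm (Q - 1)"
    by (simp only: norm_triangle_ineq)
  also have "\<dots> \<le> q * norm (D n - 1) + \<kappa> * exp \<kappa>"
  proof (rule add_mono)
    have \<Delta>: "norm (\<Delta> *\<^sub>R rep w) \<le> \<tau> * norm (rep w)"
      using step[of n] Suc.prems by (auto simp: \<Delta>_def intro!: mult_right_mono)
    have na: "norm a \<le> exp (\<tau> * norm (rep w))"
      unfolding a_def using norm_exp[of "rep (- (\<Delta> *\<^sub>R w))"] \<Delta>
      by (simp add: rep.neg rep.scaleR) (meson exp_le_cancel_iff order_trans)
    have na': "norm a' \<le> exp (\<tau> * norm (rep w))"
      unfolding a'_def using norm_exp[of "rep (\<Delta> *\<^sub>R w)"] \<Delta>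
      by (simp add: rep.scaleR) (meson exp_le_cancel_iff order_trans)
    have \<kappa>: "norm (rep (e n)) \<le> \<kappa>" using small Suc.prems by simp
    have nQ: "norm Q \<le> exp \<kappa>"
      unfolding Q_def using norm_exp[of "rep (e n)"] \<kappa> by (meson exp_le_cancel_iff order_trans)
    have "norm (a * (D n - 1) * a' * Q) \<le> norm a * norm (D n - 1) * norm a' * norm Q"
      by (meson mult_right_mono norm_ge_zero norm_mult_ineq order_trans)
    also have "\<dots> \<le> exp (\<tau> * norm (rep w)) * norm (D n - 1) * exp (\<tau> * norm (rep w)) * exp \<kappa>"
      by (intro mult_mono na na' nQ) auto
    also have "\<dots> = q * norm (D n - 1)"
    proof -
      have "2 * \<tau> * norm (rep w) + \<kappa> = \<tau> * norm (rep w) + \<tau> * norm (rep w) + \<kappa>"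
        by simp
      then have "q = exp (\<tau> * norm (rep w)) * exp (\<tau> * norm (rep w)) * exp \<kappa>"
        by (simp only: q_def exp_add)
      then show ?thesis by simp
    qed
    finally show "norm (a * (D n - 1) * a' * Q) \<le> q * norm (D n - 1)" .
    have "norm (Q - 1) \<le> norm (rep (e n)) * exp (norm (rep (e n)))"
      unfolding Q_def by (rule norm_exp_minus_1_le)
    also have "\<dots> \<le> \<kappa> * exp \<kappa>"
      using \<kappa> \<open>0 \<le> \<kappa>\<close> by (intro mult_mono) auto
    finally show "norm (Q - 1) \<le> \<kappa> * exp \<kappa>" .
  qed
  also have "\<dots> \<le> q * (q ^ n * (real n * (\<kappa> * exp \<kappa>))) + q ^ Suc n * (\<kappa> * exp \<kappa>)"
  proof (rule add_mono)
    have "1 \<le> q" using \<open>0 \<le> \<tau>\<close> \<open>0 \<le> \<kappa>\<close> by (simp add: q_def)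
    then show "q * norm (D n - 1) \<le> q * (q ^ n * (real n * (\<kappa> * exp \<kappa>)))"
      using Suc by (intro mult_left_mono) (auto simp: D_def q_def)
    have "1 \<le> q ^ Suc n" using \<open>1 \<le> q\<close> by (rule one_le_power)
    then show "\<kappa> * exp \<kappa> \<le> q ^ Suc n * (\<kappa> * exp \<kappa>)"
      using \<open>0 \<le> \<kappa>\<close> mult_right_mono[of 1 "q ^ Suc n" "\<kappa> * exp \<kappa>"] by simp
  qed
  also have "\<dots> = q ^ Suc n * (real (Suc n) * (\<kappa> * exp \<kappa>))"
    by (simp add: algebra_simps)
  finally show ?case by (simp only: D_def q_def)
qed

text \<open>
  Each of the \<open>N\<close> errors of \<open>exp_rep_product_estimate\<close> is \<open>O(1/N\<^sup>2)\<close>, by \<open>norm_nearly_horizontal\<close>, while the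
  amplification factor stays bounded, so the quotient of \<open>p N\<close> by \<open>w\<close> is \<open>O(1/N)\<close>. The threshold \<open>N\<^sub>0\<close> does
  not depend on the path \<open>p\<close>; this uniformity allows \<open>h\<close> to be chosen after \<open>N\<close>.
\<close>

lemma product_of_nearly_horizontal_increments:
  assumes w: "w \<in> layer G 1" and "0 \<le> C" and "0 < \<epsilon>"
  shows "\<exists>N\<^sub>0. \<forall>N\<ge>N\<^sub>0. \<forall>p s. p 0 = 0 \<longrightarrow> s 0 = 0 \<longrightarrow> s N = 1 \<longrightarrow>
    (\<forall>k<N. \<bar>s (Suc k) - s k\<bar> \<le> 2 / real N \<and>
      hn (gmult G (- p k) (p (Suc k))) \<le> C * (2 / real N) \<and>
      norm (comp 1 (p (Suc k)) - comp 1 (p k) - (s (Suc k) - s k) *\<^sub>R w) \<le> 1 / real N ^ 2) \<longrightarrow>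
    hn (gmult G (- w) (p N)) < \<epsilon>"
proof -
  obtain \<delta> where \<delta>: "0 < \<delta>" "\<And>x. norm x < \<delta> \<Longrightarrow> hn x < \<epsilon>"
    using hnorm_small[OF \<open>0 < \<epsilon>\<close>] by blast
  obtain M where M: "0 \<le> M" "\<And>N x. 0 < N \<Longrightarrow> hn x \<le> 2 * (norm w + C) / real N \<Longrightarrow>
      norm (comp 1 x) \<le> 1 / real N ^ 2 \<Longrightarrow> norm x \<le> M / real N ^ 2"
    using norm_nearly_horizontal[of "2 * (norm w + C)"] \<open>0 \<le> C\<close> by auto
  obtain K where K: "K > 0" "\<And>x. norm (exp (rep x) - 1) \<le> 1 \<Longrightarrow> norm x \<le> K * norm (exp (rep x) - 1)"
    using norm_le_of_exp_rep by blast
  obtain Kr where Kr: "Kr \<ge> 0" "\<And>a. norm (rep a) \<le> norm a * Kr"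
    using rep.nonneg_bounded by blast
  define b where "b = M * Kr"
  have "0 \<le> b" using M(1) Kr(1) by (simp add: b_def)
  define B where "B = exp (4 * norm (rep w) + b) * (b * exp b)"
  have "0 \<le> B" using \<open>0 \<le> b\<close> by (simp add: B_def)
  obtain N\<^sub>0 :: nat where N\<^sub>0: "B + K * B / \<delta> < real N\<^sub>0"
    using reals_Archimedean2 by blast
  show ?thesis
  proof (intro exI allI impI)
    fix N p s
    assume N: "N\<^sub>0 \<le> N" and p0: "p 0 = 0" and s0: "s 0 = (0::real)" and sN: "s N = 1"
      and inc: "\<forall>k<N. \<bar>s (Suc k) - s k\<bar> \<le> 2 / real N \<and>
        hn (gmult G (- p k) (p (Suc k))) \<le> C * (2 / real N) \<and>
        norm (comp 1 (p (Suc k)) - comp 1 (p k) - (s (Suc k) - s k) *\<^sub>R w) \<le> 1 / real N ^ 2"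
    have BN: "B + K * B / \<delta> < real N" using N\<^sub>0 N by linarith
    have nonneg: "0 \<le> K * B / \<delta>" using K(1) \<open>0 \<le> B\<close> \<delta>(1) by simp
    have "0 < real N" using BN nonneg \<open>0 \<le> B\<close> by linarith
    then have Npos: "0 < N" by simp
    define e where "e k = gmult G (- ((s (Suc k) - s k) *\<^sub>R w)) (gmult G (- p k) (p (Suc k)))" for k
    have small: "norm (rep (e k)) \<le> b / real N ^ 2" if k: "k < N" for k
    proof -
      let ?\<Delta> = "s (Suc k) - s k"
      have "hn (e k) \<le> hn (- (?\<Delta> *\<^sub>R w)) + hn (gmult G (- p k) (p (Suc k)))"
        unfolding e_def by (rule hnorm_triangle)
      also have "hn (- (?\<Delta> *\<^sub>R w)) = \<bar>?\<Delta>\<bar> * norm w"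
        by (simp add: hnorm_minus hnorm_layer_1[OF scaleR_layer_1[OF w]])
      also have "\<dots> \<le> (2 / real N) * norm w"
        using inc k by (intro mult_right_mono) auto
      also have "hn (gmult G (- p k) (p (Suc k))) \<le> C * (2 / real N)"
        using inc k by blast
      finally have "hn (e k) \<le> 2 * (norm w + C) / real N"
        by (simp add: add_divide_distrib distrib_left mult.commute)
      moreover have "comp 1 (e k) = comp 1 (p (Suc k)) - comp 1 (p k) - ?\<Delta> *\<^sub>R w"
        using component_layer_1[OF one_in_ix w]
        by (simp only: e_def component_1_gmult linear_neg[OF linear_component[OF one_in_ix]]
            linear_scale[OF linear_component[OF one_in_ix]]) simp
      then have "norm (comp 1 (e k)) \<le> 1 / real N ^ 2"
        using inc k by simp
      ultimately have "norm (e k) \<le> M / real N ^ 2"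
        using M(2)[OF Npos] by blast
      then have "norm (e k) * Kr \<le> M / real N ^ 2 * Kr"
        using Kr(1) by (rule mult_right_mono)
      then show ?thesis
        using Kr(2)[of "e k"] by (simp add: b_def)
    qed
    let ?d = "gmult G (- w) (p N)"
    have "norm (exp (rep (gmult G (- (s N *\<^sub>R w)) (p N))) - 1)
        \<le> exp (2 * (2 / real N) * norm (rep w) + b / real N ^ 2) ^ N * (real N * (b / real N ^ 2 * exp (b / real N ^ 2)))"
      by (rule exp_rep_product_estimate[where p = p and s = s and w = w and N = N])
        (use inc small \<open>0 \<le> b\<close> p0 s0 in \<open>auto simp: e_def\<close>)
    also have "\<dots> \<le> exp (4 * norm (rep w) + b) * (b * exp b / real N)"
    proof (rule mult_mono)
      have N1: "1 \<le> real N" using Npos by simp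
      have "exp (2 * (2 / real N) * norm (rep w) + b / real N ^ 2) ^ N
          = exp (real N * (2 * (2 / real N) * norm (rep w) + b / real N ^ 2))"
        by (simp only: exp_of_nat_mult)
      also have "real N * (2 * (2 / real N) * norm (rep w) + b / real N ^ 2) = 4 * norm (rep w) + b / real N"
        using Npos by (simp add: field_simps power2_eq_square)
      also have "b / real N \<le> b"
        using \<open>0 \<le> b\<close> N1 by (simp add: divide_le_eq mult_le_cancel_left1)
      finally show "exp (2 * (2 / real N) * norm (rep w) + b / real N ^ 2) ^ N \<le> exp (4 * norm (rep w) + b)"
        by simp
      have "b / real N ^ 2 \<le> b"
        using \<open>0 \<le> b\<close> N1 by (simp add: divide_le_eq mult_le_cancel_left1)
      then have "b * exp (b / real N ^ 2) / real N \<le> b * exp b / real N"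
        using \<open>0 \<le> b\<close> by (intro divide_right_mono mult_left_mono) auto
      then show "real N * (b / real N ^ 2 * exp (b / real N ^ 2)) \<le> b * exp b / real N"
        using Npos by (simp add: power2_eq_square)
    qed (use \<open>0 \<le> b\<close> in auto)
    also have "\<dots> = B / real N" by (simp add: B_def)
    finally have small_d: "norm (exp (rep ?d) - 1) \<le> B / real N" by (simp add: sN)
    have "B / real N \<le> 1"
      using BN nonneg \<open>0 < real N\<close> by (simp add: divide_le_eq)
    then have "norm ?d \<le> K * norm (exp (rep ?d) - 1)"
      using small_d by (intro K(2)) linarith
    also have "\<dots> \<le> K * (B / real N)"
      using small_d K(1) by (intro mult_left_mono) auto
    also have "\<dots> < \<delta>"
    proof -
      have "K * B / \<delta> < real N" using BN \<open>0 \<le> B\<close> by linarith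
      then show ?thesis using \<delta>(1) \<open>0 < real N\<close> by (simp add: field_simps)
    qed
    finally show "hn ?d < \<epsilon>" by (rule \<delta>(2))
  qed
qed

section \<open>Differentiability\<close>

text \<open>
  The path \<open>p k\<close> is \<open>\<gamma>\<close> at \<open>t + h s\<^sub>k\<close>, translated to start at \<open>0\<close> and dilated by \<open>1/|h|\<close>, and \<open>w\<close> is \<open>\<plusminus>v\<close>
  according to the sign of \<open>h\<close>; \<open>s\<^sub>k\<close> is a point near \<open>k/N\<close> with \<open>t + h s\<^sub>k \<in> A\<close>.
\<close>

lemma h_differentiable_at_if_horizontal_derivative:
  assumes lip: "\<And>s t. s \<in> A \<Longrightarrow> t \<in> A \<Longrightarrow> hdist G (\<gamma> s) (\<gamma> t) \<le> C * \<bar>s - t\<bar>"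
    and "t \<in> A" and dens: "density_point A t"
    and f: "\<And>s. s \<in> A \<Longrightarrow> f s = comp 1 (\<gamma> s)"
    and f': "(f has_vector_derivative v) (at t)" and v: "v \<in> layer G 1"
  shows "h_differentiable_at G A \<gamma> t"
  unfolding h_differentiable_at_def
proof (intro exI conjI)
  show "h_homomorphism G (\<lambda>h. h *\<^sub>R v)" by (rule h_homomorphism_line[OF v])
  define C' where "C' = max C 0"
  have "0 \<le> C'" by (simp add: C'_def)
  have lip': "hn (gmult G (- \<gamma> r) (\<gamma> s)) \<le> C' * \<bar>r - s\<bar>" if "r \<in> A" "s \<in> A" for r s
    using lip[OF that] mult_right_mono[of C C' "\<bar>r - s\<bar>"] by (simp add: hdist_def C'_def)
  define g where "g h = gmult G (- \<gamma> t) (\<gamma> (t + h))" for h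
  show "((\<lambda>h. hdist G (gmult G (- \<gamma> t) (\<gamma> (t + h))) (h *\<^sub>R v) / \<bar>h\<bar>) \<longlongrightarrow> 0)
      (at 0 within {h. t + h \<in> A})"
  proof (rule tendstoI)
    fix \<epsilon> :: real assume "0 < \<epsilon>"
    have mv: "- v \<in> layer G 1" using scaleR_layer_1[OF v, of "-1"] by simp
    obtain N1 where N1: "\<And>N p s. N1 \<le> N \<Longrightarrow> p 0 = 0 \<Longrightarrow> s 0 = 0 \<Longrightarrow> s N = 1 \<Longrightarrow>
        (\<And>k. k < N \<Longrightarrow> \<bar>s (Suc k) - s k\<bar> \<le> 2 / real N \<and>
          hn (gmult G (- p k) (p (Suc k))) \<le> C' * (2 / real N) \<and>
          norm (comp 1 (p (Suc k)) - comp 1 (p k) - (s (Suc k) - s k) *\<^sub>R v) \<le> 1 / real N ^ 2) \<Longrightarrow>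
        hn (gmult G (- v) (p N)) < \<epsilon>"
      using product_of_nearly_horizontal_increments[OF v \<open>0 \<le> C'\<close> \<open>0 < \<epsilon>\<close>] by blast
    obtain N2 where N2: "\<And>N p s. N2 \<le> N \<Longrightarrow> p 0 = 0 \<Longrightarrow> s 0 = 0 \<Longrightarrow> s N = 1 \<Longrightarrow>
        (\<And>k. k < N \<Longrightarrow> \<bar>s (Suc k) - s k\<bar> \<le> 2 / real N \<and>
          hn (gmult G (- p k) (p (Suc k))) \<le> C' * (2 / real N) \<and>
          norm (comp 1 (p (Suc k)) - comp 1 (p k) - (s (Suc k) - s k) *\<^sub>R (- v)) \<le> 1 / real N ^ 2) \<Longrightarrow>
        hn (gmult G (- (- v)) (p N)) < \<epsilon>"
      using product_of_nearly_horizontal_increments[OF mv \<open>0 \<le> C'\<close> \<open>0 < \<epsilon>\<close>] by blast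
    define N where "N = max 1 (max N1 N2)"
    have N: "0 < N" "N1 \<le> N" "N2 \<le> N" by (auto simp: N_def)
    \<comment> \<open>half of the admissible error, since an increment involves two points\<close>
    define \<eta> where "\<eta> = 1 / (2 * real N ^ 2)"
    have "0 < \<eta>" using N(1) by (simp add: \<eta>_def)
    obtain \<delta>1 where \<delta>1: "0 < \<delta>1"
      "\<And>y. \<bar>y\<bar> < \<delta>1 \<Longrightarrow> norm (f (t + y) - f t - y *\<^sub>R v) \<le> \<eta> * \<bar>y\<bar>"
    proof -
      obtain \<delta> where "0 < \<delta>" "\<And>z. norm (z - t) < \<delta> \<Longrightarrow> norm (f z - f t - (z - t) *\<^sub>R v) \<le> \<eta> * norm (z - t)"
        using f' \<open>0 < \<eta>\<close> unfolding has_vector_derivative_def has_derivative_at_alt by blast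
      then show thesis
        using that[of \<delta>] by (metis add_diff_cancel_left' real_norm_def)
    qed
    obtain \<delta>2 where \<delta>2: "0 < \<delta>2" "\<And>r a b. 0 < r \<Longrightarrow> r < \<delta>2 \<Longrightarrow> t - r \<le> a \<Longrightarrow> b \<le> t + r \<Longrightarrow>
        1 / real N * r \<le> b - a \<Longrightarrow> A \<inter> {a<..<b} \<noteq> {}"
      using density_point_meets[OF dens, of "1 / real N"] N(1) by auto
    have main: "hdist G (g h) (h *\<^sub>R v) / \<bar>h\<bar> < \<epsilon>"
      if h: "h \<noteq> 0" "\<bar>h\<bar> < min \<delta>1 \<delta>2" and hA: "t + h \<in> A" for h
    proof -
      define r where "r = \<bar>h\<bar>"
      have r: "0 < r" "r < \<delta>1" "r < \<delta>2" using h by (auto simp: r_def)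
      have "\<exists>s. t + h * s \<in> A \<and> \<bar>s - real k / real N\<bar> < 1 / (2 * real N)"
        if k: "0 < k" "k < N" for k
      proof -
        \<comment> \<open>the interval of radius \<open>r/(2N)\<close> about \<open>t + h k/N\<close> is long enough to meet \<open>A\<close>\<close>
        define c where "c = t + h * (real k / real N)"
        define \<rho> where "\<rho> = r / (2 * real N)"
        have "\<bar>h * (real k / real N)\<bar> + \<rho> \<le> r"
        proof -
          have "real k + 1 \<le> real N" using k by simp
          have "\<bar>h * (real k / real N)\<bar> + \<rho> = r * ((real k + 1 / 2) / real N)"
            by (simp add: abs_mult r_def \<rho>_def add_divide_distrib distrib_left)
          also have "\<dots> \<le> r * 1"
            using r(1) \<open>real k + 1 \<le> real N\<close> N(1) by (intro mult_left_mono) (auto simp: field_simps)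
          finally show ?thesis by simp
        qed
        then have "t - r \<le> c - \<rho>" "c + \<rho> \<le> t + r"
          unfolding c_def by linarith+
        moreover have "1 / real N * r \<le> (c + \<rho>) - (c - \<rho>)"
          by (simp add: \<rho>_def)
        ultimately have "A \<inter> {c - \<rho><..<c + \<rho>} \<noteq> {}"
          using \<delta>2(2) r by blast
        then obtain z where "z \<in> A" "c - \<rho> < z" "z < c + \<rho>"
          by auto
        then have z: "z \<in> A" "\<bar>z - c\<bar> < \<rho>"
          by (simp_all add: abs_less_iff)
        define s where "s = (z - t) / h"
        have "h * (s - real k / real N) = z - c"
          using h(1) by (simp add: s_def c_def field_simps)
        then have "r * \<bar>s - real k / real N\<bar> < r * (1 / (2 * real N))"
          using z(2) by (simp add: r_def \<rho>_def flip: abs_mult)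
        then have "\<bar>s - real k / real N\<bar> < 1 / (2 * real N)"
          using r(1) by (simp only: mult_less_cancel_left_pos)
        moreover have "t + h * s \<in> A"
          using z(1) h(1) by (simp add: s_def)
        ultimately show ?thesis by blast
      qed
      then obtain s' where s': "\<And>k. 0 < k \<Longrightarrow> k < N \<Longrightarrow>
          t + h * s' k \<in> A \<and> \<bar>s' k - real k / real N\<bar> < 1 / (2 * real N)"
        by metis
      define s where "s k = (if k = 0 then 0 else if k = N then 1 else s' k)" for k
      have s0: "s 0 = 0" and sN: "s N = 1" using N(1) by (auto simp: s_def)
      have sA: "t + h * s k \<in> A" if "k \<le> N" for k
        using that s'[of k] hA \<open>t \<in> A\<close> by (auto simp: s_def)
      have s_near: "\<bar>s k - real k / real N\<bar> \<le> 1 / (2 * real N)" if "k \<le> N" for k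
        using that s'[of k] N(1) by (auto simp: s_def)
      have s_le: "\<bar>s k\<bar> \<le> 1" if "k \<le> N" for k
      proof (cases "k = 0 \<or> k = N")
        case False
        then have "real k + 1 \<le> real N" "1 \<le> real k" using that by auto
        then have "real k / real N + 1 / (2 * real N) \<le> 1" "1 / (2 * real N) \<le> real k / real N"
          using N(1) by (auto simp: field_simps)
        then show ?thesis using s_near[OF that] by linarith
      qed (auto simp: s0 sN)
      have s_step: "\<bar>s (Suc k) - s k\<bar> \<le> 2 / real N" if "k < N" for k
      proof -
        have "real (Suc k) / real N - real k / real N = 1 / real N" by (simp add: add_divide_distrib)
        moreover have "1 / real N = 2 * (1 / (2 * real N))" "2 / real N = 2 * (1 / real N)" by auto
        ultimately show ?thesis
          using s_near[of k] s_near[of "Suc k"] that by linarith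
      qed
      define p where "p k = dilation G (1 / r) (g (h * s k))" for k
      have lin1: "linear (comp 1)" by (rule linear_component[OF one_in_ix])
      have p0: "p 0 = 0"
        by (simp add: p_def g_def s0 linear_0[OF linear_dilation])
      have p_inc: "gmult G (- p k) (p (Suc k))
          = dilation G (1 / r) (gmult G (- \<gamma> (t + h * s k)) (\<gamma> (t + h * s (Suc k))))" for k
      proof -
        have "gmult G (- g (h * s k)) (g (h * s (Suc k)))
            = gmult G (- \<gamma> (t + h * s k)) (\<gamma> (t + h * s (Suc k)))"
          by (simp add: g_def minus_gmult gmult_assoc)
        then show ?thesis
          by (simp add: p_def flip: dilation_gmult linear_neg[OF linear_dilation])
      qed
      have hn_inc: "hn (gmult G (- p k) (p (Suc k))) \<le> C' * (2 / real N)" if k: "k < N" for k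
      proof -
        have "hn (gmult G (- p k) (p (Suc k)))
            = 1 / r * hn (gmult G (- \<gamma> (t + h * s k)) (\<gamma> (t + h * s (Suc k))))"
          using r(1) by (simp only: p_inc hnorm_dilation zero_less_divide_1_iff)
        also have "\<dots> \<le> 1 / r * (C' * \<bar>(t + h * s k) - (t + h * s (Suc k))\<bar>)"
          using r(1) k by (intro mult_left_mono lip' sA) auto
        also have "(t + h * s k) - (t + h * s (Suc k)) = h * (s k - s (Suc k))"
          by (simp add: algebra_simps)
        also have "1 / r * (C' * \<bar>h * (s k - s (Suc k))\<bar>) = C' * \<bar>s (Suc k) - s k\<bar>"
          using r(1) by (simp add: abs_mult r_def abs_minus_commute)
        also have "\<dots> \<le> C' * (2 / real N)"
          using \<open>0 \<le> C'\<close> s_step[OF k] by (intro mult_left_mono)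
        finally show ?thesis .
      qed
      have comp_p: "comp 1 (p k) = (1 / r) *\<^sub>R (f (t + h * s k) - f t)" if "k \<le> N" for k
        using sA[OF that] \<open>t \<in> A\<close>
        by (simp only: p_def g_def component_dilation[OF one_in_ix] component_1_gmult
            linear_neg[OF lin1] f) simp
      define w where "w = (h / r) *\<^sub>R v"
      have comp_inc: "norm (comp 1 (p (Suc k)) - comp 1 (p k) - (s (Suc k) - s k) *\<^sub>R w) \<le> 1 / real N ^ 2"
        if k: "k < N" for k
      proof -
        let ?err = "\<lambda>k. f (t + h * s k) - f t - (h * s k) *\<^sub>R v"
        have err: "norm (?err j) \<le> \<eta> * r" if "j \<le> N" for j
        proof -
          have le: "\<bar>h * s j\<bar> \<le> r"
            using s_le[OF that] by (simp add: abs_mult r_def mult_left_le)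
          then have "norm (?err j) \<le> \<eta> * \<bar>h * s j\<bar>"
            using \<delta>1(2)[of "h * s j"] r(2) by simp
          also have "\<dots> \<le> \<eta> * r"
            using le \<open>0 < \<eta>\<close> by (intro mult_left_mono) auto
          finally show ?thesis .
        qed
        have "comp 1 (p (Suc k)) - comp 1 (p k) - (s (Suc k) - s k) *\<^sub>R w
            = (1 / r) *\<^sub>R (?err (Suc k) - ?err k)"
          using k by (simp add: comp_p[unfolded One_nat_def] w_def algebra_simps)
        also have "norm \<dots> \<le> 1 / r * (\<eta> * r + \<eta> * r)"
          unfolding norm_scaleR using k r(1)
          by (intro mult_mono norm_triangle_le_diff add_mono err) auto
        also have "\<dots> = 1 / real N ^ 2"
          using r(1) by (simp add: \<eta>_def)
        finally show ?thesis .
      qed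
      have "hn (gmult G (- w) (p N)) < \<epsilon>"
      proof (cases "0 < h")
        case True
        then have "w = v" by (simp add: w_def r_def)
        then show ?thesis
          using N1[of N p s] N(2) p0 s0 sN s_step hn_inc comp_inc by blast
      next
        case False
        then have "w = - v" using h(1) by (simp add: w_def r_def)
        then show ?thesis
          using N2[of N p s] N(3) p0 s0 sN s_step hn_inc comp_inc by blast
      qed
      moreover have "w = dilation G (1 / r) (h *\<^sub>R v)"
        by (simp add: w_def dilation_layer_1[OF scaleR_layer_1[OF v]])
      then have "gmult G (- w) (p N) = dilation G (1 / r) (gmult G (- (h *\<^sub>R v)) (g h))"
        by (simp add: p_def sN dilation_gmult linear_neg[OF linear_dilation])
      moreover have "hn (dilation G (1 / r) (gmult G (- (h *\<^sub>R v)) (g h)))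
          = hn (gmult G (- (h *\<^sub>R v)) (g h)) / r"
        using r(1) by (simp add: hnorm_dilation)
      moreover have "hn (gmult G (- (h *\<^sub>R v)) (g h)) = hdist G (g h) (h *\<^sub>R v)"
        unfolding hdist_def
        by (subst hnorm_minus[symmetric]) (simp add: minus_gmult)
      ultimately show ?thesis by (simp add: r_def)
    qed
    show "\<forall>\<^sub>F h in at 0 within {h. t + h \<in> A}.
        dist (hdist G (gmult G (- \<gamma> t) (\<gamma> (t + h))) (h *\<^sub>R v) / \<bar>h\<bar>) 0 < \<epsilon>"
      unfolding eventually_at
    proof (intro exI[of _ "min \<delta>1 \<delta>2"] conjI ballI impI)
      fix h assume "h \<in> {h. t + h \<in> A}" "h \<noteq> 0 \<and> dist h 0 < min \<delta>1 \<delta>2"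
      then have "hdist G (g h) (h *\<^sub>R v) / \<bar>h\<bar> < \<epsilon>"
        by (intro main) auto
      moreover have "0 \<le> hdist G (g h) (h *\<^sub>R v)"
        by (simp add: hdist_def hnorm_nonneg)
      ultimately show "dist (hdist G (gmult G (- \<gamma> t) (\<gamma> (t + h))) (h *\<^sub>R v) / \<bar>h\<bar>) 0 < \<epsilon>"
        by (simp add: g_def)
    qed (use \<delta>1(1) \<delta>2(1) in auto)
  qed
qed

lemma AE_h_differentiable:
  assumes rnp: "radon_nikodym_property (layer G 1)" and lip: "h_lipschitz_on G A \<gamma>"
  shows "AE t in lebesgue. t \<in> A \<longrightarrow> density_point A t \<and> h_differentiable_at G A \<gamma> t"
proof -
  obtain C where C: "\<And>s t. s \<in> A \<Longrightarrow> t \<in> A \<Longrightarrow> hdist G (\<gamma> s) (\<gamma> t) \<le> C * \<bar>s - t\<bar>"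
    using lip unfolding h_lipschitz_on_def by blast
  have lin1: "linear (comp 1)" by (rule linear_component[OF one_in_ix])
  have "(max C 0)-lipschitz_on A (\<lambda>t. comp 1 (\<gamma> t))"
  proof (rule lipschitz_onI)
    fix s t assume st: "s \<in> A" "t \<in> A"
    have "norm (comp 1 (\<gamma> t) - comp 1 (\<gamma> s)) \<le> hdist G (\<gamma> s) (\<gamma> t)"
      using norm_component_1_le[of "gmult G (- \<gamma> s) (\<gamma> t)"]
      unfolding component_1_gmult linear_neg[OF lin1] hdist_def by simp
    also have "\<dots> \<le> C * \<bar>s - t\<bar>" by (rule C[OF st])
    also have "\<dots> \<le> max C 0 * \<bar>s - t\<bar>" by (intro mult_right_mono) auto
    finally show "dist (comp 1 (\<gamma> s)) (comp 1 (\<gamma> t)) \<le> max C 0 * dist s t"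
      by (simp add: dist_norm norm_minus_commute)
  qed simp
  moreover have "closed (layer G 1)"
    using decomposition one_in_ix unfolding direct_sum_decomposition_def ix_def by blast
  ultimately obtain f where f: "(max C 0)-lipschitz_on UNIV f"
    "\<And>t. t \<in> A \<Longrightarrow> f t = comp 1 (\<gamma> t)" "range f \<subseteq> layer G 1"
    using lipschitz_extension_real[of "max C 0" A "\<lambda>t. comp 1 (\<gamma> t)" "layer G 1"]
      component_in_layer[OF one_in_ix] subspace_layer[OF one_in_ix] by blast
  have "AE t in lebesgue. t \<in> UNIV \<longrightarrow> (\<exists>v\<in>layer G 1. (f has_vector_derivative v) (at t within UNIV))"
    using rnp f(1,3) is_interval_univ unfolding radon_nikodym_property_def by blast
  then show ?thesis
    using AE_density_point[of A]
  proof (eventually_elim, intro impI conjI)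
    fix t
    assume diff: "t \<in> UNIV \<longrightarrow> (\<exists>v\<in>layer G 1. (f has_vector_derivative v) (at t within UNIV))"
      and dens: "t \<in> A \<longrightarrow> density_point A t" and t: "t \<in> A"
    show "density_point A t" using dens t by blast
    then show "h_differentiable_at G A \<gamma> t"
      using h_differentiable_at_if_horizontal_derivative[OF C t _ f(2)] diff by auto
  qed
qed

end

theorem theorem3p1:
  fixes G :: "'m::banach graded_structure"
    and A :: "real set"
    and \<gamma> :: "real \<Rightarrow> 'm"
  assumes "banach_homogeneous_group G"
    and "radon_nikodym_property (layer G 1)"
    and "h_lipschitz_on G A \<gamma>"
  shows "AE t in lebesgue. t \<in> A \<longrightarrow> density_point A t \<and> h_differentiable_at G A \<gamma> t"
proof -
  interpret homogeneous_group G
    using assms(1) by unfold_locales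
  show ?thesis
    using assms(2,3) by (rule AE_h_differentiable)
qed

end
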